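(* Let $(F,W,P,\boldsymbol{q})$ be a many-to-one matching market (with strict preferences, and $\boldsymbol{q}$-responsive preferences for firms) and let $\bar x$ be a stable fractional matching in it. Then $\bar x$ is strongly stable if and only if there are a connected set $\mathcal M$ of stable matchings, matchings $\mu^1,\ldots,\mu^k\in\mathcal M$ and real numbers $\alpha_1,\dots,\alpha_k$ such that $$\bar x=\sum_{l=1}^k\alpha_l x^{\mu^l},\qquad 0<\alpha_l\le1,\qquad \sum_{l=1}^k\alpha_l=1 .$$
   Context: MARKET. $F$ (firms) and $W$ (workers) are finite disjoint sets. Each worker $w$ has a strict linear order $\succ_w$ on $F\cup\{w\}$ ($w$ stands for being unmatched). Each firm $f$ has a quota $q_f$ (a positive integer) and a strict linear order $\succ_f$ on $2^W$; $\boldsymbol q=(q_f)_{f\in F}$; $P$ is the profile of all these preferences. $\succeq$ denotes "$\succ$ or equal". For workers $j,w$ write $j\succ_f w$ for $\{j\}\succ_f\{w\}$. Firms' preferences are $\boldsymbol q$-responsive: (1) $\emptyset\succ_f T$ whenever $|T|>q_f$; (2) if $|T|<q_f$ and $w\notin T$, then $T\cup\{w\}\succ_f T$ iff $\{w\}\succ_f\emptyset$; (3) if $|T|<q_f$ and $w,w'\notin T$, then $T\cup\{w\}\succ_f T\cup\{w'\}$ iff $w\succ_f w'$. A pair $(f,w)$ is acceptable if $\{w\}\succ_f\emptyset$ and $f\succ_w w$; $A=A(P)$ is the set of acceptable pairs. MATCHINGS. A matching $\mu$ assigns to each worker $w$ either one firm or $w$ itself (unmatched), and to each firm $f$ a set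 $\mu(f)\subseteq W$ with $|\mu(f)|\le q_f$, so that $\mu(w)=f$ iff $w\in\mu(f)$. $\mu$ is individually rational if every matched pair is acceptable. A pair $(f,w)$ with $\mu(w)\ne f$ blocks $\mu$ if $f\succ_w\mu(w)$ and either $|\mu(f)|=q_f$ and $w\succ_f w'$ for some $w'\in\mu(f)$, or $|\mu(f)|<q_f$ and $\{w\}\succ_f\emptyset$. $\mu$ is stable if it is individually rational and has no blocking pair. The incidence vector $x^\mu\in\{0,1\}^{F\times W}$ has $x^\mu_{f,w}=1$ iff $\mu(w)=f$. $\mu_W$ denotes the worker-optimal stable matching (every worker weakly prefers it to every other stable matching). FRACTIONAL MATCHINGS. The polytope $CP$ is the set of $x\in\mathbb{R}^{F\times W}$ with $\sum_{j\in W}x_{f,j}\le q_f$ for all $f$; $\sum_{i\in F}x_{i,w}\le 1$ for all $w$; $x_{f,w}\ge0$ for all $(f,w)$; $x_{f,w}=0$ for $(f,w)\notin A$. The polytope $SCP$ is the set of $x\in CP$ with $\sum_{j\succ_f w}x_{f,j}+q_f\sum_{i\succ_w f}x_{i,w}+q_fx_{f,w}\ge q_f$ for all $(f,w)\in A$. A stable fractional matching is a (not necessarily integer) point of $SCP$. It is strongly stable if for every $(f,w)\in A$, $$\Bigl[q_f-\sum_{j\succeq_f w}\bar x_{f,j}\Bigr]\cdot\Bigl[1-\sum_{i\succeq_w f}\bar x_{i,w}\Bigr]=0.$$ Sums over $j$ range over workers, sums over $i$ over firms. REDUCED PROFILE $P^\mu$ of a stable matching $\mu$. Start with each firm's list of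 acceptable individual workers and each worker's list of acceptable firms, ordered by preference. Step 1: for each $f$ with $\mu(f)\neq\emptyset$ remove from $f$'s list all workers preferred by $f$ to its most preferred worker in $\mu(f)$; for each $w$ remove from $w$'s list all firms preferred by $w$ to $\mu_W(w)$. Step 2: for each $w$ remove from $w$'s list all firms less preferred than $\mu(w)$; for each $f$ with $\mu_W(f)\ne\emptyset$ remove from $f$'s list all workers less preferred than its least preferred worker in $\mu_W(f)$. Step 3: after Steps 1 and 2, if $f$ is not on $w$'s list remove $w$ from $f$'s list, and if $w$ is not on $f$'s list remove $f$ from $w$'s list. The resulting lists form $P^\mu$. CYCLES. A set of firms $\sigma=\{e_1,\dots,e_r\}$ (indices mod $r$, $e_{r+1}=e_1$) is a cycle of $P^\mu$ if there are workers $w_{e_1},\dots,w_{e_r}$ such that for each $d$: $w_{e_d}$ is the most preferred worker for $e_d$ among the workers on $e_d$'s list in $P^\mu$ that are not in $\mu(e_d)$, and $w_{e_d}\in\mu(e_{d+1})$. The cyclic matching $\mu[\sigma]$ is given by $\mu[\sigma](e_d)=(\mu(e_d)\setminus\{w_{e_{d-1}}\})\cup\{w_{e_d}\}$ for $d=1,\dots,r$ (with $e_0=e_r$) and $\mu[\sigma](f)=\mu(f)$ for $f\notin\sigma$. $\Phi(\mu)$ is the set of cycles of $P^\mu$; distinct cycles in $\Phi(\mu)$ are disjoint. For $K\subseteq\Phi(\mu)$, $\mu[K]$ is the matching with $\mu[K](f)=\mu[\sigma](f)$ if $f\in\sigma\in K$ and $\mu[K](f)=\mu(f)$ if $f$ lies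 in no cycle of $K$ (so $\mu[\emptyset]=\mu$). CONNECTED SETS. A set $\mathcal M$ of stable matchings is connected if there are a stable matching $\mu$ and $K'\subseteq\Phi(\mu)$ with $\mathcal M=\mathcal M_\mu^{K'}:=\{\mu[K]:K\subseteq K'\}$. *)

theory Defs
  imports Complex_Main
begin

text \<open>
  Firms and workers are carrier sets in two different types, which makes them disjoint.
  In the preferences of a worker, \<open>Some f\<close> is the firm \<open>f\<close> and \<open>None\<close> is the worker herself
  (being unmatched). Both preference fields are strict: \<open>fpref G f S T\<close> reads
  \<open>S \<succ>\<^sub>f T\<close> and \<open>wpref G w a b\<close> reads \<open>a \<succ>\<^sub>w b\<close>.
\<close>

record ('f, 'w) market =
  firms :: "'f set"
  workers :: "'w set"
  quota :: "'f \<Rightarrow> nat"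
  fpref :: "'f \<Rightarrow> 'w set \<Rightarrow> 'w set \<Rightarrow> bool"
  wpref :: "'w \<Rightarrow> 'f option \<Rightarrow> 'f option \<Rightarrow> bool"

definition strict_linear_pref_on :: "'a set \<Rightarrow> ('a \<Rightarrow> 'a \<Rightarrow> bool) \<Rightarrow> bool" where
  "strict_linear_pref_on A R \<longleftrightarrow> irreflp_on A R \<and> transp_on A R \<and> totalp_on A R"

definition responsive :: "('f, 'w) market \<Rightarrow> 'f \<Rightarrow> bool" where
  "responsive G f \<longleftrightarrow>
     (\<forall>T \<subseteq> workers G. card T > quota G f \<longrightarrow> fpref G f {} T) \<and>
     (\<forall>T \<subseteq> workers G. \<forall>w \<in> workers G - T. card T < quota G f \<longrightarrow>
        (fpref G f (T \<union> {w}) T \<longleftrightarrow> fpref G f {w} {})) \<and>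
     (\<forall>T \<subseteq> workers G. \<forall>w \<in> workers G - T. \<forall>w' \<in> workers G - T. card T < quota G f \<longrightarrow>
        (fpref G f (T \<union> {w}) (T \<union> {w'}) \<longleftrightarrow> fpref G f {w} {w'}))"

definition many_to_one_market :: "('f, 'w) market \<Rightarrow> bool" where
  "many_to_one_market G \<longleftrightarrow>
     finite (firms G) \<and> finite (workers G) \<and>
     (\<forall>w \<in> workers G. strict_linear_pref_on (insert None (Some ` firms G)) (wpref G w)) \<and>
     (\<forall>f \<in> firms G. quota G f > 0 \<and> strict_linear_pref_on (Pow (workers G)) (fpref G f) \<and>
        responsive G f)"

definition acceptable :: "('f, 'w) market \<Rightarrow> ('f \<times> 'w) set" where
  "acceptable G = {(f, w) \<in> firms G \<times> workers G. fpref G f {w} {} \<and> wpref G w (Some f) None}"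


text \<open>
  A matching is given by its firm side \<open>f \<mapsto> \<mu>(f)\<close>; the worker side \<open>w \<mapsto> \<mu>(w)\<close> is
  \<open>partner G \<mu> w\<close>. Assigning \<open>{}\<close> outside the set of firms makes equality of
  matchings coincide with equality of functions.
\<close>

definition is_matching :: "('f, 'w) market \<Rightarrow> ('f \<Rightarrow> 'w set) \<Rightarrow> bool" where
  "is_matching G \<mu> \<longleftrightarrow>
     (\<forall>f \<in> firms G. \<mu> f \<subseteq> workers G \<and> card (\<mu> f) \<le> quota G f) \<and>
     (\<forall>f. f \<notin> firms G \<longrightarrow> \<mu> f = {}) \<and>
     (\<forall>f \<in> firms G. \<forall>g \<in> firms G. f \<noteq> g \<longrightarrow> \<mu> f \<inter> \<mu> g = {})"

definition partner :: "('f, 'w) market \<Rightarrow> ('f \<Rightarrow> 'w set) \<Rightarrow> 'w \<Rightarrow> 'f option" where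
  "partner G \<mu> w =
     (if \<exists>f \<in> firms G. w \<in> \<mu> f then Some (THE f. f \<in> firms G \<and> w \<in> \<mu> f) else None)"

definition individually_rational :: "('f, 'w) market \<Rightarrow> ('f \<Rightarrow> 'w set) \<Rightarrow> bool" where
  "individually_rational G \<mu> \<longleftrightarrow>
     (\<forall>f \<in> firms G. \<forall>w \<in> workers G. partner G \<mu> w = Some f \<longrightarrow> (f, w) \<in> acceptable G)"

definition blocks :: "('f, 'w) market \<Rightarrow> ('f \<Rightarrow> 'w set) \<Rightarrow> 'f \<Rightarrow> 'w \<Rightarrow> bool" where
  "blocks G \<mu> f w \<longleftrightarrow>
     partner G \<mu> w \<noteq> Some f \<and> wpref G w (Some f) (partner G \<mu> w) \<and>
     (card (\<mu> f) = quota G f \<and> (\<exists>w' \<in> \<mu> f. fpref G f {w} {w'}) \<or>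
      card (\<mu> f) < quota G f \<and> fpref G f {w} {})"

definition stable :: "('f, 'w) market \<Rightarrow> ('f \<Rightarrow> 'w set) \<Rightarrow> bool" where
  "stable G \<mu> \<longleftrightarrow> is_matching G \<mu> \<and> individually_rational G \<mu> \<and>
     \<not> (\<exists>f \<in> firms G. \<exists>w \<in> workers G. blocks G \<mu> f w)"

definition incidence :: "('f, 'w) market \<Rightarrow> ('f \<Rightarrow> 'w set) \<Rightarrow> 'f \<Rightarrow> 'w \<Rightarrow> real" where
  "incidence G \<mu> f w = (if partner G \<mu> w = Some f then 1 else 0)"

definition worker_optimal :: "('f, 'w) market \<Rightarrow> ('f \<Rightarrow> 'w set) \<Rightarrow> bool" where
  "worker_optimal G \<mu> \<longleftrightarrow> stable G \<mu> \<and>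
     (\<forall>\<nu>. stable G \<nu> \<longrightarrow> (\<forall>w \<in> workers G.
        wpref G w (partner G \<mu> w) (partner G \<nu> w) \<or> partner G \<mu> w = partner G \<nu> w))"

definition mu_W :: "('f, 'w) market \<Rightarrow> 'f \<Rightarrow> 'w set" where
  "mu_W G = (THE \<mu>. worker_optimal G \<mu>)"


text \<open>Points of \<open>\<real>\<^bsup>F\<times>W\<^esup>\<close> are curried functions, of which only the values on
  \<open>firms G \<times> workers G\<close> matter.\<close>

definition CP :: "('f, 'w) market \<Rightarrow> ('f \<Rightarrow> 'w \<Rightarrow> real) set" where
  "CP G = {x.
     (\<forall>f \<in> firms G. (\<Sum>j \<in> workers G. x f j) \<le> real (quota G f)) \<and>
     (\<forall>w \<in> workers G. (\<Sum>i \<in> firms G. x i w) \<le> 1) \<and>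
     (\<forall>f \<in> firms G. \<forall>w \<in> workers G. x f w \<ge> 0) \<and>
     (\<forall>f \<in> firms G. \<forall>w \<in> workers G. (f, w) \<notin> acceptable G \<longrightarrow> x f w = 0)}"

definition SCP :: "('f, 'w) market \<Rightarrow> ('f \<Rightarrow> 'w \<Rightarrow> real) set" where
  "SCP G = {x \<in> CP G. \<forall>(f, w) \<in> acceptable G.
     (\<Sum>j | j \<in> workers G \<and> fpref G f {j} {w}. x f j)
       + real (quota G f) * (\<Sum>i | i \<in> firms G \<and> wpref G w (Some i) (Some f). x i w)
       + real (quota G f) * x f w \<ge> real (quota G f)}"

abbreviation stable_fractional_matching :: "('f, 'w) market \<Rightarrow> ('f \<Rightarrow> 'w \<Rightarrow> real) \<Rightarrow> bool" where
  "stable_fractional_matching G x \<equiv> x \<in> SCP G"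

definition strongly_stable :: "('f, 'w) market \<Rightarrow> ('f \<Rightarrow> 'w \<Rightarrow> real) \<Rightarrow> bool" where
  "strongly_stable G x \<longleftrightarrow> stable_fractional_matching G x \<and>
     (\<forall>(f, w) \<in> acceptable G.
        (real (quota G f) - (\<Sum>j | j \<in> workers G \<and> (fpref G f {j} {w} \<or> j = w). x f j))
        * (1 - (\<Sum>i | i \<in> firms G \<and> (wpref G w (Some i) (Some f) \<or> i = f). x i w)) = 0)"


definition is_best_worker :: "('f, 'w) market \<Rightarrow> 'f \<Rightarrow> 'w set \<Rightarrow> 'w \<Rightarrow> bool" where
  "is_best_worker G f S w \<longleftrightarrow> w \<in> S \<and> (\<forall>w' \<in> S. fpref G f {w} {w'} \<or> w = w')"

definition best_worker :: "('f, 'w) market \<Rightarrow> 'f \<Rightarrow> 'w set \<Rightarrow> 'w" where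
  "best_worker G f S = (THE w. is_best_worker G f S w)"

definition worst_worker :: "('f, 'w) market \<Rightarrow> 'f \<Rightarrow> 'w set \<Rightarrow> 'w" where
  "worst_worker G f S = (THE w. w \<in> S \<and> (\<forall>w' \<in> S. fpref G f {w'} {w} \<or> w = w'))"

text \<open>
  The lists of the reduced profile are represented by their sets of entries, since the order of
  a list is always that of the original preferences. The suffix is the number of the step of the
  reduction; the lists after the third step form the reduced profile.
\<close>

definition firm_list1 :: "('f, 'w) market \<Rightarrow> ('f \<Rightarrow> 'w set) \<Rightarrow> 'f \<Rightarrow> 'w set" where
  "firm_list1 G \<mu> f = {w \<in> workers G. fpref G f {w} {} \<and>
     \<not> (\<mu> f \<noteq> {} \<and> fpref G f {w} {best_worker G f (\<mu> f)})}"

definition worker_list1 :: "('f, 'w) market \<Rightarrow> 'w \<Rightarrow> 'f set" where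
  "worker_list1 G w = {f \<in> firms G. wpref G w (Some f) None \<and>
     \<not> wpref G w (Some f) (partner G (mu_W G) w)}"

definition firm_list2 :: "('f, 'w) market \<Rightarrow> ('f \<Rightarrow> 'w set) \<Rightarrow> 'f \<Rightarrow> 'w set" where
  "firm_list2 G \<mu> f = {w \<in> firm_list1 G \<mu> f.
     \<not> (mu_W G f \<noteq> {} \<and> fpref G f {worst_worker G f (mu_W G f)} {w})}"

definition worker_list2 :: "('f, 'w) market \<Rightarrow> ('f \<Rightarrow> 'w set) \<Rightarrow> 'w \<Rightarrow> 'f set" where
  "worker_list2 G \<mu> w = {f \<in> worker_list1 G w. \<not> wpref G w (partner G \<mu> w) (Some f)}"

definition firm_list :: "('f, 'w) market \<Rightarrow> ('f \<Rightarrow> 'w set) \<Rightarrow> 'f \<Rightarrow> 'w set" where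
  "firm_list G \<mu> f = {w \<in> firm_list2 G \<mu> f. f \<in> worker_list2 G \<mu> w}"

definition worker_list :: "('f, 'w) market \<Rightarrow> ('f \<Rightarrow> 'w set) \<Rightarrow> 'w \<Rightarrow> 'f set" where
  "worker_list G \<mu> w = {f \<in> worker_list2 G \<mu> w. w \<in> firm_list2 G \<mu> f}"


definition is_cycle :: "('f, 'w) market \<Rightarrow> ('f \<Rightarrow> 'w set) \<Rightarrow> 'f set \<Rightarrow> bool" where
  "is_cycle G \<mu> \<sigma> \<longleftrightarrow> (\<exists>es ws.
     es \<noteq> [] \<and> distinct es \<and> \<sigma> = set es \<and> \<sigma> \<subseteq> firms G \<and> length ws = length es \<and>
     (\<forall>d < length es.
        is_best_worker G (es ! d) (firm_list G \<mu> (es ! d) - \<mu> (es ! d)) (ws ! d) \<and>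
        ws ! d \<in> \<mu> (es ! (Suc d mod length es))))"

definition cycles :: "('f, 'w) market \<Rightarrow> ('f \<Rightarrow> 'w set) \<Rightarrow> 'f set set" where
  "cycles G \<mu> = {\<sigma>. is_cycle G \<mu> \<sigma>}"

text \<open>
  The worker attached to a firm of a cycle depends on the firm only, not on the enumeration of the
  cycle. Hence the successor of a firm in a cycle is determined as well, and the predecessor of
  \<open>f\<close> is the only firm of the cycle whose attached worker lies in \<open>\<mu> f\<close>.
\<close>

definition cycle_worker :: "('f, 'w) market \<Rightarrow> ('f \<Rightarrow> 'w set) \<Rightarrow> 'f \<Rightarrow> 'w" where
  "cycle_worker G \<mu> f = best_worker G f (firm_list G \<mu> f - \<mu> f)"

definition cycle_pred :: "('f, 'w) market \<Rightarrow> ('f \<Rightarrow> 'w set) \<Rightarrow> 'f set \<Rightarrow> 'f \<Rightarrow> 'f" where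
  "cycle_pred G \<mu> \<sigma> f = (THE e. e \<in> \<sigma> \<and> cycle_worker G \<mu> e \<in> \<mu> f)"

definition cyclic_matching ::
    "('f, 'w) market \<Rightarrow> ('f \<Rightarrow> 'w set) \<Rightarrow> 'f set \<Rightarrow> 'f \<Rightarrow> 'w set" where
  "cyclic_matching G \<mu> \<sigma> f =
     (if f \<in> \<sigma>
      then (\<mu> f - {cycle_worker G \<mu> (cycle_pred G \<mu> \<sigma> f)}) \<union> {cycle_worker G \<mu> f}
      else \<mu> f)"

text \<open>The cycles in \<open>K\<close> are pairwise disjoint, so at most one of them contains \<open>f\<close>.\<close>

definition multi_cyclic_matching ::
    "('f, 'w) market \<Rightarrow> ('f \<Rightarrow> 'w set) \<Rightarrow> 'f set set \<Rightarrow> 'f \<Rightarrow> 'w set" where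
  "multi_cyclic_matching G \<mu> K f =
     (if \<exists>\<sigma> \<in> K. f \<in> \<sigma> then cyclic_matching G \<mu> (THE \<sigma>. \<sigma> \<in> K \<and> f \<in> \<sigma>) f else \<mu> f)"

definition connected_matchings :: "('f, 'w) market \<Rightarrow> ('f \<Rightarrow> 'w set) set \<Rightarrow> bool" where
  "connected_matchings G M \<longleftrightarrow>
     (\<forall>\<nu> \<in> M. stable G \<nu>) \<and>
     (\<exists>\<mu> K'. stable G \<mu> \<and> K' \<subseteq> cycles G \<mu> \<and>
        M = {multi_cyclic_matching G \<mu> K | K. K \<subseteq> K'})"

end

theory Submission
  imports Defs "HOL-Combinatorics.Cycles"
begin

text \<open>
  Convex combinations of a connected set are strongly stable because of the following: if some
  \<open>\<mu>[K]\<close> gives a worker \<open>w\<close> less than \<open>f\<close>, then so does \<open>\<mu>\<close>, hence \<open>\<mu>(f)\<close> is full and consists of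
  workers better than \<open>w\<close>; the only worker that \<open>f\<close> can gain in any \<open>\<mu>[K']\<close> is its best one on the
  reduced list, which is weakly better than \<open>w\<close>.

  Conversely, strong stability forces every edge \<open>(f, w)\<close> of the support of \<open>x\<close> to be the last one of
  \<open>w\<close>, whose weights then sum to 1, or the last one of \<open>f\<close>, whose weights then sum to the quota. The
  edges of the first kind form a matching \<open>\<mu>\<close>, and each firm has at most one further edge. Flow
  conservation shows that these further edges close up to disjoint cycles of \<open>P\<^sup>\<mu>\<close> along which their
  weights are constant, so \<open>x\<close> is a point of a cube whose vertices are the matchings \<open>\<mu>[K]\<close>.
\<close>

section \<open>Stable matchings\<close>

locale m2o_market =
  fixes G :: "('f, 'w) market"
  assumes market: "many_to_one_market G"
begin

section \<open>Preference orders of workers and of firms over single workers\<close>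

abbreviation "F \<equiv> firms G"
abbreviation "W \<equiv> workers G"
abbreviation "q \<equiv> quota G"

definition "outcomes = insert None (Some ` F)"

lemma None_in_outcomes [simp]: "None \<in> outcomes"
  and Some_in_outcomes [simp]: "Some f \<in> outcomes \<longleftrightarrow> f \<in> F"
  by (auto simp: outcomes_def)

definition wpref_eq :: "'w \<Rightarrow> 'f option \<Rightarrow> 'f option \<Rightarrow> bool" where
  "wpref_eq w a b \<longleftrightarrow> wpref G w a b \<or> a = b"

lemma finite_firms [simp]: "finite F" and finite_workers [simp]: "finite W"
  using market by (auto simp: many_to_one_market_def)

lemma quota_pos: "f \<in> F \<Longrightarrow> q f > 0"
  using market by (auto simp: many_to_one_market_def)

lemma wpref_order: "w \<in> W \<Longrightarrow> strict_linear_pref_on outcomes (wpref G w)"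
  using market by (auto simp: many_to_one_market_def outcomes_def)

lemma fpref_order: "f \<in> F \<Longrightarrow> strict_linear_pref_on (Pow W) (fpref G f)"
  using market by (auto simp: many_to_one_market_def)

lemma wpref_irrefl: "w \<in> W \<Longrightarrow> a \<in> outcomes \<Longrightarrow> \<not> wpref G w a a"
  using wpref_order unfolding strict_linear_pref_on_def irreflp_on_def by blast

lemma wpref_trans:
  "w \<in> W \<Longrightarrow> a \<in> outcomes \<Longrightarrow> b \<in> outcomes \<Longrightarrow> c \<in> outcomes \<Longrightarrow>
    wpref G w a b \<Longrightarrow> wpref G w b c \<Longrightarrow> wpref G w a c"
  using wpref_order unfolding strict_linear_pref_on_def transp_on_def by blast

lemma wpref_asym:
  "w \<in> W \<Longrightarrow> a \<in> outcomes \<Longrightarrow> b \<in> outcomes \<Longrightarrow> wpref G w a b \<Longrightarrow> \<not> wpref G w b a"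
  using wpref_trans[of w a b a] wpref_irrefl[of w a] by satx

lemma wpref_total:
  "w \<in> W \<Longrightarrow> a \<in> outcomes \<Longrightarrow> b \<in> outcomes \<Longrightarrow> wpref G w a b \<or> a = b \<or> wpref G w b a"
  using wpref_order[of w] totalp_onD[of outcomes "wpref G w" a b]
  unfolding strict_linear_pref_on_def by satx

lemma wpref_eq_trans:
  "w \<in> W \<Longrightarrow> a \<in> outcomes \<Longrightarrow> b \<in> outcomes \<Longrightarrow> c \<in> outcomes \<Longrightarrow>
    wpref_eq w a b \<Longrightarrow> wpref_eq w b c \<Longrightarrow> wpref_eq w a c"
  unfolding wpref_eq_def using wpref_trans[of w a b c] by metis

lemma wpref_wpref_eq_trans:
  "w \<in> W \<Longrightarrow> a \<in> outcomes \<Longrightarrow> b \<in> outcomes \<Longrightarrow> c \<in> outcomes \<Longrightarrow>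
    wpref G w a b \<Longrightarrow> wpref_eq w b c \<Longrightarrow> wpref G w a c"
  unfolding wpref_eq_def using wpref_trans[of w a b c] by metis

lemma not_wpref_iff:
  "w \<in> W \<Longrightarrow> a \<in> outcomes \<Longrightarrow> b \<in> outcomes \<Longrightarrow> \<not> wpref G w a b \<longleftrightarrow> wpref_eq w b a"
  unfolding wpref_eq_def using wpref_total[of w a b] wpref_asym[of w a b] wpref_irrefl[of w a] by metis

lemma fpref_irrefl: "f \<in> F \<Longrightarrow> a \<in> W \<Longrightarrow> \<not> fpref G f {a} {a}"
  using fpref_order unfolding strict_linear_pref_on_def irreflp_on_def by blast

lemma fpref_trans:
  assumes "f \<in> F" "a \<in> W" "b \<in> W" "c \<in> W" "fpref G f {a} {b}" "fpref G f {b} {c}"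
  shows "fpref G f {a} {c}"
proof -
  have "{a} \<in> Pow W" "{b} \<in> Pow W" "{c} \<in> Pow W" using assms by auto
  then show ?thesis
    using fpref_order[OF assms(1)] assms(5,6) unfolding strict_linear_pref_on_def
    by (meson transp_onD)
qed

lemma fpref_asym:
  "f \<in> F \<Longrightarrow> a \<in> W \<Longrightarrow> b \<in> W \<Longrightarrow> fpref G f {a} {b} \<Longrightarrow> \<not> fpref G f {b} {a}"
  using fpref_trans[of f a b a] fpref_irrefl[of f a] by satx

lemma fpref_total:
  assumes "f \<in> F" "a \<in> W" "b \<in> W"
  shows "fpref G f {a} {b} \<or> a = b \<or> fpref G f {b} {a}"
proof -
  have "{a} \<in> Pow W" "{b} \<in> Pow W" using assms by auto
  then show ?thesis
    using fpref_order[OF assms(1)] unfolding strict_linear_pref_on_def by (metis totalp_onD singleton_inject)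
qed

lemma best_worker_eqI:
  assumes "f \<in> F" "S \<subseteq> W" "is_best_worker G f S w"
  shows "best_worker G f S = w"
  unfolding best_worker_def
proof (rule the_equality)
  show "v = w" if "is_best_worker G f S v" for v
    using that assms(2,3) fpref_asym[OF assms(1), of v w] unfolding is_best_worker_def by blast
qed (rule assms)

lemma ex_best:
  assumes "f \<in> F" "S \<subseteq> W" "S \<noteq> {}"
  shows "\<exists>w\<in>S. \<forall>w'\<in>S. fpref G f {w} {w'} \<or> w = w'"
proof -
  have "finite S" using finite_subset[OF assms(2)] by simp
  then show ?thesis using assms(3,2)
  proof (induction rule: finite_ne_induct)
    case (insert a S)
    then obtain w where w: "w \<in> S" "\<forall>w'\<in>S. fpref G f {w} {w'} \<or> w = w'" by blast
    have "a \<in> W" "w \<in> W" using insert w by auto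
    then consider "fpref G f {a} {w}" | "fpref G f {w} {a}"
      using fpref_total[OF assms(1), of a w] insert.hyps w(1) by auto
    then show ?case
    proof cases
      case 1
      then have "\<forall>w'\<in>insert a S. fpref G f {a} {w'} \<or> a = w'"
        using w(2) fpref_trans[OF assms(1) \<open>a \<in> W\<close> \<open>w \<in> W\<close>] insert.prems by auto
      then show ?thesis by blast
    qed (use w in auto)
  qed simp
qed

lemma ex_worst:
  assumes "f \<in> F" "S \<subseteq> W" "S \<noteq> {}"
  shows "\<exists>w\<in>S. \<forall>w'\<in>S. fpref G f {w'} {w} \<or> w = w'"
proof -
  have "finite S" using finite_subset[OF assms(2)] by simp
  then show ?thesis using assms(3,2)
  proof (induction rule: finite_ne_induct)
    case (insert a S)
    then obtain w where w: "w \<in> S" "\<forall>w'\<in>S. fpref G f {w'} {w} \<or> w = w'" by blast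
    have "a \<in> W" "w \<in> W" using insert w by auto
    then consider "fpref G f {a} {w}" | "fpref G f {w} {a}"
      using fpref_total[OF assms(1), of a w] insert.hyps w(1) by auto
    then show ?case
    proof cases
      case 2
      then have "\<forall>w'\<in>insert a S. fpref G f {w'} {a} \<or> a = w'"
        using w(2) fpref_trans[OF assms(1) _ \<open>w \<in> W\<close> \<open>a \<in> W\<close>] insert.prems by auto
      then show ?thesis by blast
    qed (use w in auto)
  qed simp
qed

lemma best_worker_props:
  assumes "f \<in> F" "S \<subseteq> W" "S \<noteq> {}"
  shows "best_worker G f S \<in> S"
    and "\<forall>w'\<in>S. fpref G f {best_worker G f S} {w'} \<or> best_worker G f S = w'"
proof -
  obtain w where "is_best_worker G f S w"
    using ex_best[OF assms] unfolding is_best_worker_def by blast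
  moreover from this have "best_worker G f S = w" using best_worker_eqI assms by blast
  ultimately show "best_worker G f S \<in> S"
    and "\<forall>w'\<in>S. fpref G f {best_worker G f S} {w'} \<or> best_worker G f S = w'"
    unfolding is_best_worker_def by auto
qed

lemma worst_worker_props:
  assumes "f \<in> F" "S \<subseteq> W" "S \<noteq> {}"
  shows "worst_worker G f S \<in> S"
    and "\<forall>w'\<in>S. fpref G f {w'} {worst_worker G f S} \<or> worst_worker G f S = w'"
proof -
  have "\<exists>!w. w \<in> S \<and> (\<forall>w'\<in>S. fpref G f {w'} {w} \<or> w = w')"
  proof (rule ex_ex1I)
    show "v = w" if "v \<in> S \<and> (\<forall>w'\<in>S. fpref G f {w'} {v} \<or> v = w')"
      "w \<in> S \<and> (\<forall>w'\<in>S. fpref G f {w'} {w} \<or> w = w')" for v w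
      using that assms(2) fpref_asym[OF assms(1), of v w] by blast
  qed (use ex_worst[OF assms] in blast)
  from theI'[OF this] show "worst_worker G f S \<in> S"
    and "\<forall>w'\<in>S. fpref G f {w'} {worst_worker G f S} \<or> worst_worker G f S = w'"
    unfolding worst_worker_def by auto
qed

section \<open>Matchings, partners and blocking pairs\<close>

lemma acceptable_iff:
  "(f, w) \<in> acceptable G \<longleftrightarrow> f \<in> F \<and> w \<in> W \<and> fpref G f {w} {} \<and> wpref G w (Some f) None"
  by (auto simp: acceptable_def)

lemma partner_eq_Some_iff:
  assumes "is_matching G \<mu>"
  shows "partner G \<mu> w = Some f \<longleftrightarrow> w \<in> \<mu> f"
proof -
  have uniq: "g = f" if "w \<in> \<mu> f" "w \<in> \<mu> g" for f g
    using that assms unfolding is_matching_def by blast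
  have "f \<in> F" if "w \<in> \<mu> f" for f using that assms unfolding is_matching_def by auto
  moreover have "(THE g. g \<in> F \<and> w \<in> \<mu> g) = f" if "f \<in> F" "w \<in> \<mu> f" for f
    using that uniq by blast
  ultimately show ?thesis unfolding partner_def by auto
qed

lemma partner_in_outcomes: "is_matching G \<mu> \<Longrightarrow> partner G \<mu> w \<in> outcomes"
proof -
  assume a: "is_matching G \<mu>"
  show ?thesis
  proof (cases "partner G \<mu> w")
    case (Some f)
    then have "w \<in> \<mu> f" using partner_eq_Some_iff a by blast
    then have "f \<in> F" using a unfolding is_matching_def by auto
    then show ?thesis using Some by simp
  qed simp
qed

lemma matching_memD:
  assumes "is_matching G \<mu>" "w \<in> \<mu> f"
  shows "f \<in> F" "w \<in> W"
proof -
  show "f \<in> F" using assms unfolding is_matching_def by auto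
  then show "w \<in> W" using assms unfolding is_matching_def by auto
qed

lemma stable_matching: "stable G \<mu> \<Longrightarrow> is_matching G \<mu>"
  by (simp add: stable_def)

lemma stable_outcomes: "stable G \<mu> \<Longrightarrow> partner G \<mu> w \<in> outcomes"
  using partner_in_outcomes stable_matching by blast

lemma stable_acceptable: "stable G \<mu> \<Longrightarrow> w \<in> \<mu> f \<Longrightarrow> (f, w) \<in> acceptable G"
  using matching_memD[of \<mu> w f] partner_eq_Some_iff[of \<mu> w f]
  unfolding stable_def individually_rational_def by blast

text \<open>A vacancy at \<open>f\<close> would already let the acceptable pair block, so
  \<open>f\<close> is full, and totality turns the absence of a worse worker into strict preference.
  Stability is applied in this form throughout.\<close>

lemma stable_no_block:
  assumes st: "stable G \<mu>" and acc: "(f, w) \<in> acceptable G"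
    and pr: "wpref G w (Some f) (partner G \<mu> w)"
  shows "card (\<mu> f) = q f" "\<And>j. j \<in> \<mu> f \<Longrightarrow> fpref G f {j} {w}" "w \<notin> \<mu> f"
proof -
  have m: "is_matching G \<mu>" using st stable_matching by blast
  have fw: "f \<in> F" "w \<in> W" "fpref G f {w} {}" using acc by (auto simp: acceptable_iff)
  have ne: "partner G \<mu> w \<noteq> Some f" using wpref_irrefl fw pr by fastforce
  then show nin: "w \<notin> \<mu> f" using partner_eq_Some_iff[OF m] by blast
  have nb: "\<not> blocks G \<mu> f w" using st fw unfolding stable_def by blast
  have "card (\<mu> f) \<le> q f" using m fw unfolding is_matching_def by blast
  then show c: "card (\<mu> f) = q f" using nb ne pr fw unfolding blocks_def by linarith
  show "fpref G f {j} {w}" if "j \<in> \<mu> f" for j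
  proof -
    have "\<not> fpref G f {w} {j}" using nb ne pr c that unfolding blocks_def by blast
    moreover have "j \<noteq> w" "j \<in> W" using that nin matching_memD[OF m] by auto
    ultimately show ?thesis using fpref_total fw by blast
  qed
qed

text \<open>Checking acceptable pairs suffices, because a blocking pair is acceptable: on the
  worker's side by transitivity through her current partner, on the firm's side through the vacancy
  or the acceptable worker \<open>j\<close> that would be displaced.\<close>

lemma stableI:
  assumes m: "is_matching G \<mu>"
    and acc: "\<And>f w. w \<in> \<mu> f \<Longrightarrow> (f, w) \<in> acceptable G"
    and nb: "\<And>f w. (f, w) \<in> acceptable G \<Longrightarrow> wpref G w (Some f) (partner G \<mu> w) \<Longrightarrow>
      card (\<mu> f) = q f \<and> (\<forall>j\<in>\<mu> f. fpref G f {j} {w})"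
  shows "stable G \<mu>"
proof -
  have "\<not> blocks G \<mu> f w" if fw: "f \<in> F" "w \<in> W" for f w
  proof
    assume b: "blocks G \<mu> f w"
    have pr: "wpref G w (Some f) (partner G \<mu> w)" using b by (simp add: blocks_def)
    have "wpref G w (Some f) None"
    proof (cases "partner G \<mu> w")
      case (Some g)
      then have "(g, w) \<in> acceptable G" using acc partner_eq_Some_iff[OF m] by blast
      then show ?thesis using wpref_trans[OF fw(2), of "Some f" "Some g" None] Some pr fw
        by (auto simp: acceptable_iff)
    qed (use pr in simp)
    moreover have "fpref G f {w} {}"
    proof (rule ccontr)
      assume "\<not> fpref G f {w} {}"
      then obtain j where j: "j \<in> \<mu> f" "fpref G f {w} {j}" using b unfolding blocks_def by blast
      have "fpref G f {j} {}" "j \<in> W" using acc[OF j(1)] by (auto simp: acceptable_iff)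
      moreover have "{j} \<in> Pow W" "{w} \<in> Pow W" "{} \<in> Pow W" using fw \<open>j \<in> W\<close> by auto
      ultimately have "fpref G f {w} {}" using fpref_order[OF fw(1)] j(2)
        unfolding strict_linear_pref_on_def by (meson transp_onD)
      then show False using \<open>\<not> fpref G f {w} {}\<close> by simp
    qed
    ultimately have "(f, w) \<in> acceptable G" using fw by (simp add: acceptable_iff)
    note full = nb[OF this pr]
    then obtain j where j: "j \<in> \<mu> f" "fpref G f {w} {j}" using b unfolding blocks_def by auto
    moreover from this have "j \<in> W" using matching_memD[OF m] by blast
    ultimately show False using full fpref_asym[OF fw(1,2)] by blast
  qed
  then show ?thesis
    unfolding stable_def individually_rational_def using m acc partner_eq_Some_iff[OF m] by blast
qed

section \<open>Joins of stable matchings and the worker-optimal matching\<close>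

lemma partner_of_choice:
  assumes "\<And>w. w \<in> W \<Longrightarrow> t w \<in> outcomes" "w \<in> W"
  shows "partner G (\<lambda>f. {w \<in> W. t w = Some f}) w = t w"
proof (cases "t w")
  case None
  then show ?thesis unfolding partner_def by simp
next
  case (Some f)
  then have "f \<in> F" using assms by fastforce
  then show ?thesis unfolding partner_def using Some assms(2) by auto
qed

text \<open>The sets \<open>\<mu> f\<close> partition the matched workers.\<close>

lemma sum_card_matching:
  assumes "is_matching G \<mu>"
  shows "(\<Sum>f\<in>F. card (\<mu> f)) = card {w \<in> W. partner G \<mu> w \<noteq> None}"
proof -
  have "{w \<in> W. partner G \<mu> w \<noteq> None} = (\<Union>f\<in>F. \<mu> f)"
    using partner_eq_Some_iff[OF assms] matching_memD[OF assms] by blast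
  moreover have "finite (\<mu> f)" if "f \<in> F" for f
    using assms that finite_subset[of "\<mu> f" W] unfolding is_matching_def by auto
  ultimately show ?thesis
    using card_UN_disjoint[of F \<mu>] assms unfolding is_matching_def by simp
qed

text \<open>Every worker picks the better of her two partners. No firm then receives more workers
  than in \<open>\<mu>\<close> or in \<open>\<nu>\<close>, while no worker matched in either becomes
  unmatched; comparing totals forces equality at every firm. A worker who still prefers
  \<open>f\<close> does so against both matchings, so both \<open>\<mu> f\<close> and
  \<open>\<nu> f\<close> are full and lie above her.\<close>

lemma stable_join:
  assumes "stable G \<mu>" "stable G \<nu>"
  obtains \<eta> where "stable G \<eta>"
    "\<And>w. w \<in> W \<Longrightarrow> wpref_eq w (partner G \<eta> w) (partner G \<mu> w)"
    "\<And>w. w \<in> W \<Longrightarrow> wpref_eq w (partner G \<eta> w) (partner G \<nu> w)"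
    "\<And>f. card (\<mu> f) = card (\<nu> f)"
proof -
  note m = stable_matching[OF assms(1)] stable_matching[OF assms(2)]
  note p\<mu> = partner_eq_Some_iff[OF m(1)] and p\<nu> = partner_eq_Some_iff[OF m(2)]
  note o\<mu> = partner_in_outcomes[OF m(1)] and o\<nu> = partner_in_outcomes[OF m(2)]
  define t where
    "t w = (if wpref G w (partner G \<nu> w) (partner G \<mu> w) then partner G \<nu> w else partner G \<mu> w)" for w
  define \<eta> where "\<eta> = (\<lambda>f. {w \<in> W. t w = Some f})"
  have tO: "t w \<in> outcomes" for w using o\<mu> o\<nu> by (simp add: t_def)
  have pl: "partner G \<eta> w = t w" if "w \<in> W" for w
    unfolding \<eta>_def using partner_of_choice[of t] tO that by blast
  have t\<mu>: "wpref_eq w (t w) (partner G \<mu> w)" and t\<nu>: "wpref_eq w (t w) (partner G \<nu> w)"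
    if "w \<in> W" for w
    using not_wpref_iff[OF that o\<nu> o\<mu>] unfolding t_def wpref_eq_def by auto
  have l_sub: "\<eta> f \<subseteq> \<mu> f \<union> \<nu> f" for f using p\<mu> p\<nu> unfolding \<eta>_def t_def by (auto split: if_splits)
  have new\<mu>: "card (\<nu> f) = q f \<and> (\<forall>j\<in>\<nu> f. fpref G f {j} {w})" if "w \<in> \<eta> f" "w \<notin> \<nu> f" for f w
  proof -
    have w: "w \<in> W" "w \<in> \<mu> f" "t w = Some f" using that l_sub unfolding \<eta>_def by auto
    have "wpref G w (Some f) (partner G \<nu> w)"
      using t\<nu>[OF w(1)] w(3) that(2) p\<nu>[of w f] unfolding wpref_eq_def by auto
    then show ?thesis using stable_no_block[OF assms(2) stable_acceptable[OF assms(1) w(2)]] by blast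
  qed
  have new\<nu>: "card (\<mu> f) = q f \<and> (\<forall>j\<in>\<mu> f. fpref G f {j} {w})" if "w \<in> \<eta> f" "w \<notin> \<mu> f" for f w
  proof -
    have w: "w \<in> W" "w \<in> \<nu> f" "t w = Some f" using that l_sub unfolding \<eta>_def by auto
    have "wpref G w (Some f) (partner G \<mu> w)"
      using t\<mu>[OF w(1)] w(3) that(2) p\<mu>[of w f] unfolding wpref_eq_def by auto
    then show ?thesis using stable_no_block[OF assms(1) stable_acceptable[OF assms(2) w(2)]] by blast
  qed
  have fin: "finite (\<mu> f)" "finite (\<nu> f)" for f
    using finite_subset[OF subsetI finite_workers] matching_memD(2)[OF m(1)] matching_memD(2)[OF m(2)]
    by blast+
  \<comment> \<open>A newcomer \<open>v\<close> outside \<open>\<mu> f\<close> ranks below all of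
    \<open>\<mu> f\<close>, and a newcomer \<open>w\<close> outside \<open>\<nu> f\<close> ranks
    below all of \<open>\<nu> f\<close>. Having both would place each of them below the
    other.\<close>
  have one_side: "\<eta> f \<subseteq> \<mu> f \<or> \<eta> f \<subseteq> \<nu> f" for f
  proof (rule ccontr)
    assume "\<not> ?thesis"
    then obtain v w where v: "v \<in> \<eta> f" "v \<notin> \<mu> f" and w: "w \<in> \<eta> f" "w \<notin> \<nu> f" by blast
    then have "v \<in> \<nu> f" "w \<in> \<mu> f" using l_sub by blast+
    moreover from this have "f \<in> F" "v \<in> W" "w \<in> W" using m matching_memD by blast+
    ultimately show False using new\<mu>[OF w] new\<nu>[OF v] fpref_asym[of f v w] by blast
  qed
  have le\<mu>: "card (\<eta> f) \<le> card (\<mu> f)" and le\<nu>: "card (\<eta> f) \<le> card (\<nu> f)" if "f \<in> F" for f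
  proof -
    have qb: "card (\<mu> f) \<le> q f" "card (\<nu> f) \<le> q f" using m that unfolding is_matching_def by auto
    \<comment> \<open>If \<open>\<eta> f\<close> is not contained in one of the two sets, then that
      set is full, so the missing bound comes from the quota.\<close>
    have cases: "\<eta> f \<subseteq> \<mu> f \<and> \<eta> f \<subseteq> \<nu> f \<or> \<eta> f \<subseteq> \<mu> f \<and> card (\<nu> f) = q f \<or>
        \<eta> f \<subseteq> \<nu> f \<and> card (\<mu> f) = q f"
      using one_side[of f] new\<mu>[of _ f] new\<nu>[of _ f] by blast
    have "\<eta> f \<subseteq> \<mu> f \<Longrightarrow> card (\<eta> f) \<le> card (\<mu> f)" "\<eta> f \<subseteq> \<nu> f \<Longrightarrow> card (\<eta> f) \<le> card (\<nu> f)"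
      using card_mono fin by blast+
    then show "card (\<eta> f) \<le> card (\<mu> f)" "card (\<eta> f) \<le> card (\<nu> f)"
      using cases qb by (elim disjE conjE; simp)+
  qed
  have ml: "is_matching G \<eta>"
    unfolding is_matching_def
  proof (intro conjI ballI allI impI)
    show "\<eta> f \<subseteq> W" for f by (auto simp: \<eta>_def)
    show "card (\<eta> f) \<le> q f" if "f \<in> F" for f
      using le\<mu>[OF that] m(1) that unfolding is_matching_def by fastforce
    show "\<eta> f = {}" if "f \<notin> F" for f
      using tO that Some_in_outcomes unfolding \<eta>_def by (metis (mono_tags, lifting) Collect_empty_eq)
    show "\<eta> f \<inter> \<eta> g = {}" if "f \<noteq> g" for f g using that unfolding \<eta>_def by auto
  qed
  have t_None: "wpref_eq w (Some f) None" if "partner G \<mu> w = Some f \<or> partner G \<nu> w = Some f" for w f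
    using that p\<mu> p\<nu> stable_acceptable[OF assms(1)] stable_acceptable[OF assms(2)]
    unfolding wpref_eq_def acceptable_iff by blast
  have matched: "t w \<noteq> None" if w: "w \<in> W" and some: "partner G \<mu> w \<noteq> None \<or> partner G \<nu> w \<noteq> None" for w
  proof
    assume "t w = None"
    moreover obtain f where f: "partner G \<mu> w = Some f \<or> partner G \<nu> w = Some f" using some by blast
    ultimately have "wpref_eq w None (Some f)" using t\<mu>[OF w] t\<nu>[OF w] by auto
    moreover have "Some f \<in> outcomes" using f o\<mu> o\<nu> by metis
    ultimately show False using t_None[OF f] wpref_asym[OF w, of None "Some f"]
      unfolding wpref_eq_def by auto
  qed
  \<comment> \<open>Totals are compared on the workers' side, where matched workers stay matched.
    The reverse inequality is summed over firms, so each termwise bound must be tight.\<close>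
  have "(\<Sum>f\<in>F. card (\<mu> f)) \<le> (\<Sum>f\<in>F. card (\<eta> f))" "(\<Sum>f\<in>F. card (\<nu> f)) \<le> (\<Sum>f\<in>F. card (\<eta> f))"
    unfolding sum_card_matching[OF m(1)] sum_card_matching[OF m(2)] sum_card_matching[OF ml]
    using matched pl by (auto intro!: card_mono)
  moreover have "(\<Sum>f\<in>F. card (\<eta> f)) \<le> (\<Sum>f\<in>F. card (\<mu> f))"
    "(\<Sum>f\<in>F. card (\<eta> f)) \<le> (\<Sum>f\<in>F. card (\<nu> f))"
    using le\<mu> le\<nu> by (auto intro!: sum_mono)
  ultimately have sums: "(\<Sum>f\<in>F. card (\<eta> f)) = (\<Sum>f\<in>F. card (\<mu> f))"
    "(\<Sum>f\<in>F. card (\<eta> f)) = (\<Sum>f\<in>F. card (\<nu> f))"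
    by linarith+
  have "card (\<eta> f) = card (\<mu> f)" "card (\<eta> f) = card (\<nu> f)" if "f \<in> F" for f
    using sum_mono_inv[OF sums(1) le\<mu> that] sum_mono_inv[OF sums(2) le\<nu> that] by simp_all
  moreover have "card (\<mu> f) = card (\<nu> f)" if "f \<notin> F" for f
    using m that unfolding is_matching_def by auto
  ultimately have cards: "card (\<mu> f) = card (\<nu> f)" "f \<in> F \<Longrightarrow> card (\<eta> f) = card (\<mu> f)" for f
    by (cases "f \<in> F"; simp)+
  have "stable G \<eta>"
  proof (rule stableI[OF ml])
    show "(f, w) \<in> acceptable G" if "w \<in> \<eta> f" for f w
      using that l_sub assms stable_acceptable by blast
  next
    fix f w assume acc: "(f, w) \<in> acceptable G" and pr: "wpref G w (Some f) (partner G \<eta> w)"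
    then have fw: "f \<in> F" "w \<in> W" "Some f \<in> outcomes" by (auto simp: acceptable_iff)
    have "wpref G w (Some f) (t w)" using pr pl[OF fw(2)] by simp
    then have "wpref G w (Some f) (partner G \<mu> w)" "wpref G w (Some f) (partner G \<nu> w)"
      using wpref_wpref_eq_trans[OF fw(2,3) tO o\<mu> _ t\<mu>[OF fw(2)]]
        wpref_wpref_eq_trans[OF fw(2,3) tO o\<nu> _ t\<nu>[OF fw(2)]] by blast+
    from stable_no_block[OF assms(1) acc this(1)] stable_no_block[OF assms(2) acc this(2)]
    show "card (\<eta> f) = q f \<and> (\<forall>j\<in>\<eta> f. fpref G f {j} {w})"
      using cards(2)[OF fw(1)] l_sub[of f] by auto
  qed
  then show ?thesis using that[of \<eta>] t\<mu> t\<nu> pl cards(1) by simp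
qed

lemma stable_card_eq: "stable G \<mu> \<Longrightarrow> stable G \<nu> \<Longrightarrow> card (\<mu> f) = card (\<nu> f)"
  by (rule stable_join)

lemma finite_stable: "finite {\<mu>. stable G \<mu>}"
proof (rule finite_subset)
  show "{\<mu>. stable G \<mu>} \<subseteq> {\<mu>. \<forall>f. (f \<in> F \<longrightarrow> \<mu> f \<in> Pow W) \<and> (f \<notin> F \<longrightarrow> \<mu> f = {})}"
    unfolding stable_def is_matching_def by auto
  show "finite {\<mu>. \<forall>f. (f \<in> F \<longrightarrow> \<mu> f \<in> Pow W) \<and> (f \<notin> F \<longrightarrow> \<mu> f = {})}"
    by (rule finite_set_of_finite_funs) auto
qed

text \<open>The definite description in \<open>mu_W\<close> needs existence and uniqueness.
  Existence comes from iterating joins over the finite set of all stable matchings, with the given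
  \<open>\<mu>\<close> serving the base case; uniqueness is antisymmetry of the workers'
  orders.\<close>

lemma worker_optimal_mu_W:
  assumes "stable G \<mu>"
  shows "worker_optimal G (mu_W G)"
proof -
  have "\<exists>\<eta>. stable G \<eta> \<and> (\<forall>\<nu>\<in>S. \<forall>w\<in>W. wpref_eq w (partner G \<eta> w) (partner G \<nu> w))"
    if "finite S" "S \<subseteq> {\<mu>. stable G \<mu>}" for S
    using that
  proof (induction S)
    case empty
    then show ?case using assms by blast
  next
    case (insert \<nu> S)
    then obtain \<eta> where l: "stable G \<eta>" "\<forall>\<nu>\<in>S. \<forall>w\<in>W. wpref_eq w (partner G \<eta> w) (partner G \<nu> w)"
      by auto
    have st: "\<And>\<nu>'. \<nu>' \<in> insert \<nu> S \<Longrightarrow> stable G \<nu>'" using insert by auto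
    obtain \<kappa> where k: "stable G \<kappa>" "\<And>w. w \<in> W \<Longrightarrow> wpref_eq w (partner G \<kappa> w) (partner G \<eta> w)"
      "\<And>w. w \<in> W \<Longrightarrow> wpref_eq w (partner G \<kappa> w) (partner G \<nu> w)"
      by (rule stable_join[OF l(1) st[OF insertI1]]) simp
    have "wpref_eq w (partner G \<kappa> w) (partner G \<nu>' w)" if n: "\<nu>' \<in> insert \<nu> S" and w: "w \<in> W" for \<nu>' w
    proof (cases "\<nu>' = \<nu>")
      case False
      then have "wpref_eq w (partner G \<eta> w) (partner G \<nu>' w)" using n w l(2) by blast
      then show ?thesis
        by (rule wpref_eq_trans[OF w stable_outcomes[OF k(1)] stable_outcomes[OF l(1)]
              stable_outcomes[OF st[OF n]] k(2)[OF w]])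
    qed (use k(3)[OF w] in simp)
    then show ?case using k(1) by blast
  qed
  from this[OF finite_stable subset_refl] obtain \<eta> where l: "worker_optimal G \<eta>"
    unfolding worker_optimal_def wpref_eq_def by blast
  have "\<nu> = \<eta>" if n: "worker_optimal G \<nu>" for \<nu>
  proof
    fix f
    have st: "stable G \<nu>" "stable G \<eta>" using n l unfolding worker_optimal_def by auto
    have eq: "partner G \<nu> w = partner G \<eta> w" if "w \<in> W" for w
    proof -
      have "wpref_eq w (partner G \<nu> w) (partner G \<eta> w)" "wpref_eq w (partner G \<eta> w) (partner G \<nu> w)"
        using n l st that unfolding worker_optimal_def wpref_eq_def by auto
      then show ?thesis
        using wpref_asym[OF that stable_outcomes[OF st(1), of w] stable_outcomes[OF st(2), of w]]
        unfolding wpref_eq_def by auto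
    qed
    note m = st[THEN stable_matching]
    have "w \<in> \<nu> f \<longleftrightarrow> w \<in> \<eta> f" for w
      using eq[of w] partner_eq_Some_iff[OF m(1), of w f] partner_eq_Some_iff[OF m(2), of w f]
        matching_memD(2)[OF m(1), of w f] matching_memD(2)[OF m(2), of w f] by auto
    then show "\<nu> f = \<eta> f" by blast
  qed
  then show ?thesis unfolding mu_W_def using l by (metis theI)
qed

lemma mu_W_stable: "stable G \<mu> \<Longrightarrow> stable G (mu_W G)"
  using worker_optimal_mu_W unfolding worker_optimal_def by blast

lemma mu_W_best:
  "stable G \<mu> \<Longrightarrow> w \<in> W \<Longrightarrow> wpref_eq w (partner G (mu_W G) w) (partner G \<mu> w)"
  using worker_optimal_mu_W unfolding worker_optimal_def wpref_eq_def by blast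


subsection \<open>Reduced profiles and cyclic matchings\<close>

text \<open>For workers outside \<open>\<mu> f\<close>, the three reduction steps become two bounds
  on the place of \<open>f\<close> in the order of \<open>w\<close> and a lower cut in the order of
  \<open>f\<close>. In the converse direction the cut at the best worker of \<open>\<mu> f\<close>
  is respected, since stability puts \<open>w\<close> below all of \<open>\<mu> f\<close>.\<close>

lemma firm_list_diff_iff:
  assumes st: "stable G \<mu>"
  shows "w \<in> firm_list G \<mu> f - \<mu> f \<longleftrightarrow> (f, w) \<in> acceptable G \<and>
    wpref G w (Some f) (partner G \<mu> w) \<and> wpref_eq w (partner G (mu_W G) w) (Some f) \<and>
    \<not> (mu_W G f \<noteq> {} \<and> fpref G f {worst_worker G f (mu_W G f)} {w})"
    (is "?L \<longleftrightarrow> ?R")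
proof
  note m = stable_matching[OF st] and oW = stable_outcomes[OF mu_W_stable[OF st]]
  {
    assume L: ?L
    then have fw: "f \<in> F" "w \<in> W" and acc: "(f, w) \<in> acceptable G"
      by (auto simp: firm_list_def firm_list2_def firm_list1_def worker_list2_def worker_list1_def
          acceptable_iff)
    have "\<not> wpref G w (Some f) (partner G (mu_W G) w)" "\<not> wpref G w (partner G \<mu> w) (Some f)"
      using L by (auto simp: firm_list_def worker_list2_def worker_list1_def)
    then have "wpref_eq w (partner G (mu_W G) w) (Some f)" "wpref_eq w (Some f) (partner G \<mu> w)"
      using not_wpref_iff[OF fw(2)] oW stable_outcomes[OF st] fw by auto
    moreover have "partner G \<mu> w \<noteq> Some f" using L partner_eq_Some_iff[OF m] by blast
    ultimately show ?R using acc L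
      by (auto simp: wpref_eq_def firm_list_def firm_list2_def)
  next
    assume R: ?R
    then have fw: "f \<in> F" "w \<in> W" and acc: "(f, w) \<in> acceptable G"
      and pr: "wpref G w (Some f) (partner G \<mu> w)"
      by (auto simp: acceptable_iff)
    note nb = stable_no_block[OF st acc pr]
    have "\<not> wpref G w (Some f) (partner G (mu_W G) w)"
      using R not_wpref_iff[OF fw(2)] oW fw by auto
    moreover have "\<not> wpref G w (partner G \<mu> w) (Some f)"
      using wpref_asym[OF fw(2)] stable_outcomes[OF st] fw pr by auto
    moreover have "\<not> (\<mu> f \<noteq> {} \<and> fpref G f {w} {best_worker G f (\<mu> f)})"
    proof
      assume a: "\<mu> f \<noteq> {} \<and> fpref G f {w} {best_worker G f (\<mu> f)}"
      have sub: "\<mu> f \<subseteq> W" using matching_memD[OF m] by blast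
      then have b: "best_worker G f (\<mu> f) \<in> \<mu> f" using best_worker_props[OF fw(1)] a by blast
      then show False
        using nb(2)[OF b] a fpref_asym[OF fw(1), of w "best_worker G f (\<mu> f)"] fw sub by blast
    qed
    ultimately show ?L using nb(3) R acc
      by (auto simp: acceptable_iff firm_list_def firm_list2_def firm_list1_def worker_list2_def
          worker_list1_def)
  }
qed

lemma worst_worker_mu_W:
  assumes "stable G \<mu>" "f \<in> F" "mu_W G f \<noteq> {}"
  shows "worst_worker G f (mu_W G f) \<in> mu_W G f" "worst_worker G f (mu_W G f) \<in> W"
    "\<And>w. w \<in> mu_W G f \<Longrightarrow> fpref G f {w} {worst_worker G f (mu_W G f)} \<or> worst_worker G f (mu_W G f) = w"
proof -
  have sub: "mu_W G f \<subseteq> W"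
    using matching_memD(2)[OF stable_matching[OF mu_W_stable[OF assms(1)]]] by blast
  note props = worst_worker_props[OF assms(2) sub assms(3)]
  show "worst_worker G f (mu_W G f) \<in> mu_W G f" using props(1) .
  then show "worst_worker G f (mu_W G f) \<in> W" using sub by blast
  show "\<And>w. w \<in> mu_W G f \<Longrightarrow> fpref G f {w} {worst_worker G f (mu_W G f)} \<or> worst_worker G f (mu_W G f) = w"
    using props(2) by blast
qed

lemma best_in_firm_list:
  assumes "stable G \<mu>" "is_best_worker G f (firm_list G \<mu> f - \<mu> f) v"
  shows "(f, v) \<in> acceptable G" "card (\<mu> f) = q f" "\<And>j. j \<in> \<mu> f \<Longrightarrow> fpref G f {j} {v}"
    "\<not> (mu_W G f \<noteq> {} \<and> fpref G f {worst_worker G f (mu_W G f)} {v})"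
proof -
  have "v \<in> firm_list G \<mu> f - \<mu> f" using assms(2) unfolding is_best_worker_def by blast
  note iff = this[unfolded firm_list_diff_iff[OF assms(1)]]
  then show acc: "(f, v) \<in> acceptable G" by blast
  have pr: "wpref G v (Some f) (partner G \<mu> v)" using iff by blast
  show "card (\<mu> f) = q f" "\<And>j. j \<in> \<mu> f \<Longrightarrow> fpref G f {j} {v}"
    using stable_no_block[OF assms(1) acc pr] by blast+
  show "\<not> (mu_W G f \<noteq> {} \<and> fpref G f {worst_worker G f (mu_W G f)} {v})" using iff by blast
qed

lemma firm_list_subset: "firm_list G \<mu> f \<subseteq> W"
  by (auto simp: firm_list_def firm_list2_def firm_list1_def)

text \<open>The worker that \<open>f\<close> can gain is determined by \<open>f\<close> alone,
  whichever cycle of \<open>K\<close> contains it. Later arguments use just this dichotomy and never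
  follow a cycle.\<close>

lemma multi_cyclic_matching_cases:
  assumes "K \<subseteq> cycles G \<mu>"
  obtains "multi_cyclic_matching G \<mu> K f = \<mu> f"
  | v where "f \<in> F" "is_best_worker G f (firm_list G \<mu> f - \<mu> f) v"
      "v \<in> multi_cyclic_matching G \<mu> K f" "multi_cyclic_matching G \<mu> K f \<subseteq> insert v (\<mu> f)"
proof (cases "\<exists>\<sigma>\<in>K. f \<in> \<sigma>")
  case True
  then obtain \<sigma> where s: "is_cycle G \<mu> \<sigma>" "f \<in> \<sigma>" using assms by (auto simp: cycles_def)
  then obtain v where v: "f \<in> F" "is_best_worker G f (firm_list G \<mu> f - \<mu> f) v"
    unfolding is_cycle_def by (metis in_set_conv_nth subsetD)
  have "cycle_worker G \<mu> f = v"
    unfolding cycle_worker_def by (rule best_worker_eqI) (use v firm_list_subset in auto)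
  moreover have "multi_cyclic_matching G \<mu> K f = cyclic_matching G \<mu> (THE \<sigma>. \<sigma> \<in> K \<and> f \<in> \<sigma>) f"
    using True by (simp add: multi_cyclic_matching_def)
  \<comment> \<open>The first alternative absorbs the case that the set denoted by
    \<open>THE\<close> does not contain \<open>f\<close>.\<close>
  ultimately have "multi_cyclic_matching G \<mu> K f = \<mu> f \<or>
      v \<in> multi_cyclic_matching G \<mu> K f \<and> multi_cyclic_matching G \<mu> K f \<subseteq> insert v (\<mu> f)"
    unfolding cyclic_matching_def by auto
  then show ?thesis using that v by blast
next
  case False
  then show ?thesis using that(1) by (simp add: multi_cyclic_matching_def)
qed

text \<open>If \<open>w\<close> ended up below her old firm \<open>g\<close>, stability of the new
  matching would fill \<open>g\<close> with workers above \<open>w\<close>. But \<open>g\<close>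
  either kept \<open>\<mu> g\<close>, which contains \<open>w\<close>, or gained a worker ranked
  below all of \<open>\<mu> g\<close>.\<close>

lemma multi_cyclic_matching_improves:
  assumes st: "stable G \<mu>" and K: "K \<subseteq> cycles G \<mu>"
    and st': "stable G (multi_cyclic_matching G \<mu> K)" (is "stable G ?\<nu>") and w: "w \<in> W"
  shows "wpref_eq w (partner G ?\<nu> w) (partner G \<mu> w)"
proof (rule ccontr)
  assume "\<not> ?thesis"
  then have worse: "wpref G w (partner G \<mu> w) (partner G ?\<nu> w)"
    using not_wpref_iff[OF w] stable_outcomes[OF st, of w] stable_outcomes[OF st', of w] by blast
  show False
  proof (cases "partner G \<mu> w")
    case None
    then obtain g where g: "partner G ?\<nu> w = Some g"
      using worse wpref_irrefl[OF w None_in_outcomes] by (metis not_None_eq)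
    then have "(g, w) \<in> acceptable G"
      using stable_acceptable[OF st'] partner_eq_Some_iff[OF stable_matching[OF st']] by blast
    then show False using worse None g wpref_asym[OF w, of "None" "Some g"]
      by (auto simp: acceptable_iff)
  next
    case (Some g)
    then have wg: "w \<in> \<mu> g" using partner_eq_Some_iff[OF stable_matching[OF st]] by blast
    have acc: "(g, w) \<in> acceptable G" using stable_acceptable[OF st wg] .
    note nb = stable_no_block[OF st' acc worse[unfolded Some]]
    from K show False
    proof (cases rule: multi_cyclic_matching_cases[of K \<mu> g])
      case 1
      then show False using wg nb(3) by blast
    next
      case (2 v)
      have "v \<in> W" using best_in_firm_list(1)[OF st 2(2)] by (simp add: acceptable_iff)
      then show False
        using nb(2)[OF 2(3)] best_in_firm_list(3)[OF st 2(2) wg] fpref_asym[OF 2(1), of v w] w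
        by blast
    qed
  qed
qed

text \<open>Saturation transfers between members of a connected set: the worker is left below
  \<open>f\<close> in the member given by \<open>K\<close>, hence also in \<open>\<mu>\<close>, and
  the conclusion concerns an arbitrary member \<open>K'\<close>.\<close>

lemma multi_cyclic_matching_saturated:
  assumes st: "stable G \<mu>" and K: "K \<subseteq> cycles G \<mu>" "K' \<subseteq> cycles G \<mu>"
    and st1: "stable G (multi_cyclic_matching G \<mu> K)"
    and st2: "stable G (multi_cyclic_matching G \<mu> K')" (is "stable G ?\<nu>")
    and acc: "(f, w) \<in> acceptable G"
    and pr: "wpref G w (Some f) (partner G (multi_cyclic_matching G \<mu> K) w)"
  shows "card (?\<nu> f) = q f" "j \<in> ?\<nu> f \<Longrightarrow> fpref G f {j} {w} \<or> j = w"
proof -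
  have fw: "f \<in> F" "w \<in> W" using acc by (auto simp: acceptable_iff)
  have pr0: "wpref G w (Some f) (partner G \<mu> w)"
    by (rule wpref_wpref_eq_trans[OF fw(2) _ _ _ pr multi_cyclic_matching_improves[OF st K(1) st1 fw(2)]])
      (use fw stable_outcomes st st1 in auto)
  note nb = stable_no_block[OF st acc pr0]
  show "card (?\<nu> f) = q f" using nb(1) stable_card_eq[OF st st2] by simp
  assume j: "j \<in> ?\<nu> f"
  from K(2) show "fpref G f {j} {w} \<or> j = w"
  proof (cases rule: multi_cyclic_matching_cases[of K' \<mu> f])
    case 1
    then show ?thesis using nb(2) j by simp
  next
    case (2 v)
    note bv = best_in_firm_list[OF st 2(2)]
    note stW = mu_W_stable[OF st]
    have vW: "v \<in> W" using bv(1) by (simp add: acceptable_iff)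
    have "fpref G f {v} {w} \<or> v = w"
    proof (rule ccontr)
      assume a: "\<not> ?thesis"
      then have wv: "fpref G f {w} {v}" using fpref_total[OF fw(1) vW fw(2)] by blast
      \<comment> \<open>A worker above the best entry \<open>v\<close> must have been removed from
        the list. Either the lower cut removed her, or she prefers \<open>f\<close> to her partner
        in \<open>mu_W G\<close>, and then stability puts all of \<open>mu_W G f\<close> above her.
        In both cases the worst worker of \<open>mu_W G f\<close> lies above \<open>w\<close>, hence
        above \<open>v\<close>, who would have been removed too.\<close>
      have "w \<notin> firm_list G \<mu> f - \<mu> f"
        using 2(2) a fpref_asym[OF fw(1) vW fw(2)] unfolding is_best_worker_def by blast
      then consider "\<not> wpref_eq w (partner G (mu_W G) w) (Some f)"
        | "mu_W G f \<noteq> {}" "fpref G f {worst_worker G f (mu_W G f)} {w}"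
        using firm_list_diff_iff[OF st] acc pr0 by blast
      then have W: "mu_W G f \<noteq> {} \<and> fpref G f {worst_worker G f (mu_W G f)} {w}"
      proof cases
        case 1
        then have "wpref G w (Some f) (partner G (mu_W G) w)"
          using not_wpref_iff[OF fw(2), of "Some f" "partner G (mu_W G) w"] stable_outcomes[OF stW] fw
          by auto
        note nbW = stable_no_block[OF stW acc this]
        then have "mu_W G f \<noteq> {}" using quota_pos[OF fw(1)] by force
        then show ?thesis using nbW(2)[OF worst_worker_mu_W(1)[OF st fw(1)]] by blast
      qed blast
      moreover from this have "worst_worker G f (mu_W G f) \<in> W"
        using worst_worker_mu_W(2)[OF st fw(1)] by simp
      ultimately show False using bv(4) fpref_trans[OF fw(1) _ fw(2) vW _ wv] by simp
    qed
    then show ?thesis using 2(4) j nb(2) by auto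
  qed
qed

section \<open>Strong stability of convex combinations of a connected set\<close>

lemma sum_incidence_firms:
  assumes "is_matching G \<mu>" "S \<subseteq> F"
  shows "(\<Sum>i\<in>S. incidence G \<mu> i w) = (if \<exists>i\<in>S. partner G \<mu> w = Some i then 1 else 0)"
proof -
  have fin: "finite S" using finite_subset[OF assms(2)] by simp
  have "(\<Sum>i\<in>S. incidence G \<mu> i w) = (\<Sum>i\<in>S. if i = the (partner G \<mu> w) \<and> partner G \<mu> w \<noteq> None then 1 else 0)"
    by (rule sum.cong) (auto simp: incidence_def)
  also have "\<dots> = (if \<exists>i\<in>S. partner G \<mu> w = Some i then 1 else 0)"
    using fin by (cases "partner G \<mu> w") auto
  finally show ?thesis .
qed

lemma sum_incidence_workers:
  assumes "is_matching G \<mu>" "S \<subseteq> W"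
  shows "(\<Sum>j\<in>S. incidence G \<mu> f j) = real (card (\<mu> f \<inter> S))"
proof -
  have fin: "finite S" using finite_subset[OF assms(2)] by simp
  have "(\<Sum>j\<in>S. incidence G \<mu> f j) = (\<Sum>j\<in>S. if j \<in> \<mu> f then 1 else 0)"
    by (rule sum.cong) (auto simp: incidence_def partner_eq_Some_iff[OF assms(1)])
  also have "\<dots> = (\<Sum>j\<in>S \<inter> \<mu> f. 1)"
    using sum.inter_restrict[OF fin, of "\<lambda>_. 1 :: real" "\<mu> f"] by simp
  finally show ?thesis by (simp add: Int_commute)
qed

text \<open>If one \<open>\<mu> l\<close> gives \<open>w\<close> no firm weakly above
  \<open>f\<close>, saturation makes every matching contribute the full quota to the first sum, so
  the first factor vanishes. Otherwise every matching contributes 1 to the second sum, and the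
  second factor vanishes.\<close>

lemma connected_convex_combination_product:
  fixes \<alpha> :: "nat \<Rightarrow> real"
  assumes conn: "connected_matchings G M"
    and M: "\<And>l. l \<in> {1..k} \<Longrightarrow> \<mu> l \<in> M" and sum1: "(\<Sum>l = 1..k. \<alpha> l) = 1"
    and x: "\<And>f w. f \<in> F \<Longrightarrow> w \<in> W \<Longrightarrow> x f w = (\<Sum>l = 1..k. \<alpha> l * incidence G (\<mu> l) f w)"
    and acc: "(f, w) \<in> acceptable G"
  shows "(real (q f) - (\<Sum>j | j \<in> W \<and> (fpref G f {j} {w} \<or> j = w). x f j))
        * (1 - (\<Sum>i | i \<in> F \<and> (wpref G w (Some i) (Some f) \<or> i = f). x i w)) = 0"
proof -
  have fw: "f \<in> F" "w \<in> W" using acc by (auto simp: acceptable_iff)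
  obtain \<mu>0 K' where m0: "stable G \<mu>0" "K' \<subseteq> cycles G \<mu>0"
    "M = {multi_cyclic_matching G \<mu>0 K | K. K \<subseteq> K'}" and stM: "\<forall>\<nu>\<in>M. stable G \<nu>"
    using conn unfolding connected_matchings_def by blast
  have st: "stable G (\<mu> l)" "is_matching G (\<mu> l)" if "l \<in> {1..k}" for l
    using M[OF that] stM stable_matching by blast+
  let ?S = "{j. j \<in> W \<and> (fpref G f {j} {w} \<or> j = w)}"
  let ?T = "{i. i \<in> F \<and> (wpref G w (Some i) (Some f) \<or> i = f)}"
  have sumT: "(\<Sum>i\<in>?T. x i w) = (\<Sum>l = 1..k. \<alpha> l * (\<Sum>i\<in>?T. incidence G (\<mu> l) i w))"
  proof -
    have "(\<Sum>i\<in>?T. x i w) = (\<Sum>i\<in>?T. \<Sum>l = 1..k. \<alpha> l * incidence G (\<mu> l) i w)"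
      by (rule sum.cong) (use x fw in auto)
    also have "\<dots> = (\<Sum>l = 1..k. \<Sum>i\<in>?T. \<alpha> l * incidence G (\<mu> l) i w)" by (rule sum.swap)
    finally show ?thesis by (simp add: sum_distrib_left)
  qed
  have sumS: "(\<Sum>j\<in>?S. x f j) = (\<Sum>l = 1..k. \<alpha> l * (\<Sum>j\<in>?S. incidence G (\<mu> l) f j))"
  proof -
    have "(\<Sum>j\<in>?S. x f j) = (\<Sum>j\<in>?S. \<Sum>l = 1..k. \<alpha> l * incidence G (\<mu> l) f j)"
      by (rule sum.cong) (use x fw in auto)
    also have "\<dots> = (\<Sum>l = 1..k. \<Sum>j\<in>?S. \<alpha> l * incidence G (\<mu> l) f j)" by (rule sum.swap)
    finally show ?thesis by (simp add: sum_distrib_left)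
  qed
  show ?thesis
  proof (cases "\<exists>l\<in>{1..k}. \<forall>i\<in>?T. partner G (\<mu> l) w \<noteq> Some i")
    case True
    then obtain l where l: "l \<in> {1..k}" "\<forall>i\<in>?T. partner G (\<mu> l) w \<noteq> Some i" by blast
    have pr: "wpref G w (Some f) (partner G (\<mu> l) w)"
    proof (cases "partner G (\<mu> l) w")
      case None
      then show ?thesis using acc by (simp add: acceptable_iff)
    next
      case (Some g)
      then have "g \<in> F" "\<not> wpref G w (Some g) (Some f)" "g \<noteq> f"
        using l(2) stable_outcomes[OF st(1)[OF l(1)], of w] by auto
      then show ?thesis using Some wpref_total[OF fw(2), of "Some f" "Some g"] fw by auto
    qed
    obtain K where K: "K \<subseteq> K'" "\<mu> l = multi_cyclic_matching G \<mu>0 K" using M[OF l(1)] m0(3) by blast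
    have "(\<Sum>j\<in>?S. incidence G (\<mu> l') f j) = real (q f)" if l': "l' \<in> {1..k}" for l'
    proof -
      obtain L where L: "L \<subseteq> K'" "\<mu> l' = multi_cyclic_matching G \<mu>0 L" using M[OF l'] m0(3) by blast
      have "K \<subseteq> cycles G \<mu>0" "L \<subseteq> cycles G \<mu>0" using K L m0(2) by blast+
      note sat = multi_cyclic_matching_saturated[OF m0(1) this, folded K(2) L(2), OF st(1)[OF l(1)] st(1)[OF l'] acc pr]
      have "\<mu> l' f \<subseteq> ?S" using sat(2) matching_memD[OF st(2)[OF l']] by blast
      then show ?thesis using sum_incidence_workers[OF st(2)[OF l'], of ?S f] sat(1)
        by (simp add: Int_absorb2)
    qed
    then have "(\<Sum>j\<in>?S. x f j) = (\<Sum>l = 1..k. \<alpha> l * real (q f))" unfolding sumS by simp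
    then show ?thesis using sum1 by (simp flip: sum_distrib_right)
  next
    case False
    then have "(\<Sum>i\<in>?T. incidence G (\<mu> l) i w) = 1" if "l \<in> {1..k}" for l
      using sum_incidence_firms[OF st(2)[OF that], of ?T w] that by auto
    then have "(\<Sum>i\<in>?T. x i w) = 1" unfolding sumT using sum1 by simp
    then show ?thesis by simp
  qed
qed

end


section \<open>Strongly stable points\<close>

text \<open>Weights of the vertices: choose each \<open>s\<close> independently with probability \<open>\<beta> s\<close>.\<close>

lemma cube_convex_combination:
  fixes \<beta> :: "'a \<Rightarrow> real"
  assumes S: "finite S" and \<beta>: "\<And>s. s \<in> S \<Longrightarrow> 0 < \<beta> s \<and> \<beta> s < 1"
  obtains k :: nat and K :: "nat \<Rightarrow> 'a set" and \<alpha> :: "nat \<Rightarrow> real"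
  where "\<And>l. l \<in> {1..k} \<Longrightarrow> K l \<subseteq> S" "\<And>l. l \<in> {1..k} \<Longrightarrow> 0 < \<alpha> l \<and> \<alpha> l \<le> 1"
    "(\<Sum>l = 1..k. \<alpha> l) = 1" "\<And>s. s \<in> S \<Longrightarrow> (\<Sum>l = 1..k. \<alpha> l * of_bool (s \<in> K l)) = \<beta> s"
proof -
  define wt where "wt X = (\<Prod>s\<in>X. \<beta> s) * (\<Prod>s\<in>S - X. 1 - \<beta> s)" for X
  obtain K where K: "bij_betw K {1..card (Pow S)} (Pow S)"
    using ex_bij_betw_nat_finite_1[of "Pow S"] S by auto
  let ?k = "card (Pow S)"
  have reindex: "(\<Sum>l = 1..?k. g (K l)) = (\<Sum>X\<in>Pow S. g X)" for g :: "'a set \<Rightarrow> real"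
    by (rule sum.reindex_bij_betw[OF K])
  have pos: "0 < wt X" if "X \<subseteq> S" for X
    unfolding wt_def using that \<beta> by (intro mult_pos_pos prod_pos) auto
  have one: "(\<Sum>X\<in>Pow S. wt X) = 1"
    unfolding wt_def using prod_add[OF S, of \<beta> "\<lambda>s. 1 - \<beta> s"] by simp
  have sub: "K l \<subseteq> S" if "l \<in> {1..?k}" for l using bij_betwE[OF K] that by blast
  have posK: "0 < wt (K l)" if "l \<in> {1..?k}" for l using pos[OF sub[OF that]] .
  show thesis
  proof
    show "K l \<subseteq> S" if "l \<in> {1..?k}" for l using sub[OF that] .
    show sum1: "(\<Sum>l = 1..?k. wt (K l)) = 1" using reindex[of wt] one by simp
    show "0 < wt (K l) \<and> wt (K l) \<le> 1" if l: "l \<in> {1..?k}" for l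
    proof
      show "0 < wt (K l)" using posK[OF l] .
      show "wt (K l) \<le> 1"
        unfolding sum1[symmetric] by (rule member_le_sum) (use l posK in \<open>auto intro: less_imp_le\<close>)
    qed
    show "(\<Sum>l = 1..?k. wt (K l) * of_bool (s \<in> K l)) = \<beta> s" if s: "s \<in> S" for s
    proof -
      \<comment> \<open>Replacing the factor for omitting \<open>s\<close> by 0 annihilates exactly
        the subsets without \<open>s\<close>, so the restricted sum is again the expansion of a
        product.\<close>
      define \<gamma> where "\<gamma> t = (if t = s then 0 else 1 - \<beta> t)" for t
      have "wt X * of_bool (s \<in> X) = (\<Prod>t\<in>X. \<beta> t) * (\<Prod>t\<in>S - X. \<gamma> t)" if X: "X \<in> Pow S" for X
      proof (cases "s \<in> X")
        case True
        then have "(\<Prod>t\<in>S - X. \<gamma> t) = (\<Prod>t\<in>S - X. 1 - \<beta> t)"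
          by (intro prod.cong) (auto simp: \<gamma>_def)
        then show ?thesis using True by (simp add: wt_def)
      next
        case False
        then have "(\<Prod>t\<in>S - X. \<gamma> t) = 0"
          by (intro prod_zero) (use S s in \<open>auto simp: \<gamma>_def\<close>)
        then show ?thesis using False by simp
      qed
      then have "(\<Sum>X\<in>Pow S. wt X * of_bool (s \<in> X)) = (\<Prod>t\<in>S. \<beta> t + \<gamma> t)"
        unfolding prod_add[OF S] by (rule sum.cong[OF refl])
      also have "\<dots> = \<beta> s * (\<Prod>t\<in>S - {s}. \<beta> t + \<gamma> t)"
        using prod.remove[OF S s, of "\<lambda>t. \<beta> t + \<gamma> t"] by (simp add: \<gamma>_def)
      also have "(\<Prod>t\<in>S - {s}. \<beta> t + \<gamma> t) = 1"
        by (rule prod.neutral) (simp add: \<gamma>_def)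
      finally show ?thesis using reindex[of "\<lambda>X. wt X * of_bool (s \<in> X)"] by simp
    qed
  qed
qed

section \<open>Saturated edges and the support of a strongly stable point\<close>

locale strongly_stable_point = m2o_market G for G :: "('f, 'w) market" +
  fixes x :: "'f \<Rightarrow> 'w \<Rightarrow> real"
  assumes strong: "strongly_stable G x"
begin

text \<open>\<open>wsat\<close> and \<open>fsat\<close> express that the second, respectively the
  first, factor in the strong stability condition vanishes.\<close>

definition wsat :: "'f \<Rightarrow> 'w \<Rightarrow> bool" where
  "wsat f w \<longleftrightarrow> (\<Sum>i | i \<in> F \<and> (wpref G w (Some i) (Some f) \<or> i = f). x i w) = 1"

definition fsat :: "'f \<Rightarrow> 'w \<Rightarrow> bool" where
  "fsat f w \<longleftrightarrow> (\<Sum>j | j \<in> W \<and> (fpref G f {j} {w} \<or> j = w). x f j) = real (q f)"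

lemma in_CP: "x \<in> CP G"
  using strong by (simp add: strongly_stable_def SCP_def)

lemma row_le: "f \<in> F \<Longrightarrow> (\<Sum>j\<in>W. x f j) \<le> real (q f)"
  and col_le: "w \<in> W \<Longrightarrow> (\<Sum>i\<in>F. x i w) \<le> 1"
  and x_nonneg: "f \<in> F \<Longrightarrow> w \<in> W \<Longrightarrow> 0 \<le> x f w"
  using in_CP by (auto simp: CP_def)

lemma x_pos_acceptable: "f \<in> F \<Longrightarrow> w \<in> W \<Longrightarrow> 0 < x f w \<Longrightarrow> (f, w) \<in> acceptable G"
  using in_CP by (force simp: CP_def)

lemma fsat_or_wsat: "(f, w) \<in> acceptable G \<Longrightarrow> fsat f w \<or> wsat f w"
  using strong unfolding strongly_stable_def fsat_def wsat_def by fastforce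

text \<open>A positive term outside \<open>T\<close> would push the sum over \<open>A\<close> above
  the sum over \<open>T\<close>.\<close>

lemma sum_saturated_support:
  fixes g :: "'a \<Rightarrow> real"
  assumes "finite A" "T \<subseteq> A" "\<And>a. a \<in> A \<Longrightarrow> 0 \<le> g a" "sum g A \<le> sum g T" "a \<in> A" "0 < g a"
  shows "a \<in> T"
proof (rule ccontr)
  assume "a \<notin> T"
  have fin: "finite T" using assms(1,2) finite_subset by blast
  have "sum g (insert a T) \<le> sum g A" using assms by (intro sum_mono2) auto
  then show False using assms(4,6) \<open>a \<notin> T\<close> fin by simp
qed

text \<open>The firms weakly above \<open>f\<close> already exhaust the total of at most 1 in the
  column of \<open>w\<close>, so no support firm of \<open>w\<close> lies below
  \<open>f\<close>.\<close>

lemma wsat_support: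
  assumes "wsat f w" "w \<in> W" "g \<in> F" "0 < x g w"
  shows "g = f \<or> wpref G w (Some g) (Some f)"
proof -
  have "g \<in> {i. i \<in> F \<and> (wpref G w (Some i) (Some f) \<or> i = f)}"
  proof (rule sum_saturated_support[where g = "\<lambda>i. x i w", OF finite_firms _ _ _ assms(3,4)])
    show "0 \<le> x i w" if "i \<in> F" for i using x_nonneg[OF that assms(2)] .
  qed (use assms(1) col_le[OF assms(2)] in \<open>auto simp: wsat_def\<close>)
  then show ?thesis by blast
qed

lemma wsat_col:
  assumes "wsat f w" "w \<in> W"
  shows "(\<Sum>i\<in>F. x i w) = 1"
proof -
  have "(\<Sum>i | i \<in> F \<and> (wpref G w (Some i) (Some f) \<or> i = f). x i w) \<le> (\<Sum>i\<in>F. x i w)"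
    using x_nonneg assms(2) by (intro sum_mono2) auto
  then show ?thesis using assms col_le[OF assms(2)] unfolding wsat_def by linarith
qed

lemma fsat_row:
  assumes "fsat f w" "f \<in> F"
  shows "(\<Sum>j\<in>W. x f j) = real (q f)"
proof -
  have "(\<Sum>j | j \<in> W \<and> (fpref G f {j} {w} \<or> j = w). x f j) \<le> (\<Sum>j\<in>W. x f j)"
    using x_nonneg assms(2) by (intro sum_mono2) auto
  then show ?thesis using assms row_le[OF assms(2)] unfolding fsat_def by linarith
qed

lemma fsat_support:
  assumes "fsat f w" "f \<in> F" "j \<in> W" "0 < x f j"
  shows "j = w \<or> fpref G f {j} {w}"
proof -
  have "j \<in> {j. j \<in> W \<and> (fpref G f {j} {w} \<or> j = w)}"
  proof (rule sum_saturated_support[where g = "x f", OF finite_workers _ _ _ assms(3,4)])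
    show "0 \<le> x f i" if "i \<in> W" for i using x_nonneg[OF assms(2) that] .
  qed (use assms(1) row_le[OF assms(2)] in \<open>auto simp: fsat_def\<close>)
  then show ?thesis by blast
qed

text \<open>
  \<open>base\<close> is the matching \<open>\<mu>\<close> of the introduction, and \<open>extra f\<close>, which is junk unless \<open>f\<close> is
  fractional, is the worker on the further edge of \<open>f\<close>.
\<close>

definition base :: "'f \<Rightarrow> 'w set" where
  "base f = {w \<in> W. f \<in> F \<and> 0 < x f w \<and> wsat f w}"

definition fractional :: "'f set" where
  "fractional = {f \<in> F. \<exists>w\<in>W. 0 < x f w \<and> \<not> wsat f w}"

definition extra :: "'f \<Rightarrow> 'w" where
  "extra f = (SOME w. w \<in> W \<and> 0 < x f w \<and> \<not> wsat f w)"

lemma finite_fractional [simp]: "finite fractional" and fractional_firm: "f \<in> fractional \<Longrightarrow> f \<in> F"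
  by (auto simp: fractional_def)

lemma baseD: "w \<in> base f \<Longrightarrow> f \<in> F" "w \<in> base f \<Longrightarrow> w \<in> W" "w \<in> base f \<Longrightarrow> 0 < x f w"
  "w \<in> base f \<Longrightarrow> wsat f w"
  by (auto simp: base_def)

lemma finite_base [simp]: "finite (base f)"
  by (auto simp: base_def)

lemma extra_props:
  assumes "f \<in> fractional"
  shows "extra f \<in> W" "0 < x f (extra f)" "\<not> wsat f (extra f)" "fsat f (extra f)"
proof -
  have "\<exists>w. w \<in> W \<and> 0 < x f w \<and> \<not> wsat f w" using assms by (auto simp: fractional_def)
  from someI_ex[OF this, folded extra_def]
  show p: "extra f \<in> W" "0 < x f (extra f)" "\<not> wsat f (extra f)" by blast+
  then show "fsat f (extra f)"
    using fsat_or_wsat[OF x_pos_acceptable[OF fractional_firm[OF assms]]] by blast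
qed

text \<open>An edge that is not \<open>wsat\<close> is \<open>fsat\<close>, so its worker is the
  least preferred one in the support of \<open>f\<close>. There is only one such worker, which makes
  the choice in \<open>extra\<close> unambiguous.\<close>

lemma support_cases:
  assumes f: "f \<in> F" and w: "w \<in> W" and x: "0 < x f w"
  shows "w \<in> base f \<or> f \<in> fractional \<and> w = extra f"
proof (cases "wsat f w")
  case False
  then have fr: "f \<in> fractional" using assms by (auto simp: fractional_def)
  note e = extra_props[OF fr]
  have "fsat f w" using fsat_or_wsat[OF x_pos_acceptable[OF assms]] False by blast
  then have "w = extra f"
    using fsat_support[OF _ f e(1,2)] fsat_support[OF e(4) f w x] fpref_asym[OF f w e(1)] by blast
  then show ?thesis using fr by blast
qed (use assms base_def in auto)

lemma extra_notin_base: "f \<in> fractional \<Longrightarrow> extra f \<notin> base f"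
  using extra_props(3) baseD(4) by blast

text \<open>Both firms would be the least preferred one in the support of \<open>w\<close>.\<close>

lemma base_unique:
  assumes "w \<in> base f" "w \<in> base g"
  shows "f = g"
proof -
  note f = baseD[OF assms(1)] and g = baseD[OF assms(2)]
  show ?thesis
    using wsat_support[OF f(4,2) g(1,3)] wsat_support[OF g(4,2) f(1,3)]
      wpref_asym[OF f(2), of "Some f" "Some g"] f(1) g(1) by auto
qed

text \<open>An edge of weight 1 would saturate its worker by itself.\<close>

lemma extra_lt_1:
  assumes fr: "f \<in> fractional"
  shows "x f (extra f) < 1"
proof -
  note e = extra_props[OF fr] and f = fractional_firm[OF fr]
  let ?T = "{i. i \<in> F \<and> (wpref G (extra f) (Some i) (Some f) \<or> i = f)}"
  have "x f (extra f) \<le> (\<Sum>i\<in>?T. x i (extra f))"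
    by (rule member_le_sum) (use f e(1) x_nonneg in auto)
  moreover have "(\<Sum>i\<in>?T. x i (extra f)) \<le> (\<Sum>i\<in>F. x i (extra f))"
    using x_nonneg e(1) by (intro sum_mono2) auto
  ultimately show ?thesis using col_le[OF e(1)] e(3) unfolding wsat_def by linarith
qed

text \<open>The column of \<open>w\<close> sums to 1, and its support consists of \<open>f\<close>
  and the firms whose extra worker is \<open>w\<close>.\<close>

lemma base_value:
  assumes w: "w \<in> base f"
  shows "x f w = 1 - (\<Sum>e | e \<in> fractional \<and> extra e = w. x e (extra e))"
proof -
  note b = baseD[OF w]
  let ?E = "{e. e \<in> fractional \<and> extra e = w}"
  have fin: "finite ?E" by simp
  have f: "f \<notin> ?E" using extra_notin_base w by auto
  have "x i w = 0" if i: "i \<in> F - insert f ?E" for i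
  proof (rule ccontr)
    assume "x i w \<noteq> 0"
    then have "0 < x i w" using x_nonneg[of i w] i b by simp
    then have "w \<in> base i \<or> i \<in> fractional \<and> w = extra i" using support_cases i b by simp
    then show False using base_unique[OF w] i by auto
  qed
  then have "(\<Sum>i\<in>F. x i w) = (\<Sum>i\<in>insert f ?E. x i w)"
    using b(1) fractional_firm by (intro sum.mono_neutral_right) auto
  also have "\<dots> = x f w + (\<Sum>e\<in>?E. x e w)" using fin f by (rule sum.insert)
  also have "(\<Sum>e\<in>?E. x e w) = (\<Sum>e\<in>?E. x e (extra e))" by (rule sum.cong) auto
  finally show ?thesis using wsat_col[OF b(4,2)] by simp
qed

section \<open>Flow conservation along the extra edges\<close>

definition feeders :: "'f \<Rightarrow> 'f set" where
  "feeders f = {e \<in> fractional. extra e \<in> base f}"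

text \<open>Flow balance at \<open>f\<close>: each base edge counts 1 minus the weight that feeders
  take from its worker, and the extra edge of \<open>f\<close> adds its own weight. Grouping feeders
  by the worker they share with \<open>f\<close> collects the losses.\<close>

lemma row_sum:
  assumes f: "f \<in> F"
  shows "(\<Sum>j\<in>W. x f j) = real (card (base f)) - (\<Sum>e\<in>feeders f. x e (extra e))
    + (if f \<in> fractional then x f (extra f) else 0)"
proof -
  let ?X = "if f \<in> fractional then {extra f} else {}"
  have "x f j = 0" if j: "j \<in> W - (base f \<union> ?X)" for j
  proof (rule ccontr)
    assume "x f j \<noteq> 0"
    then have "0 < x f j" using x_nonneg[of f j] j f by simp
    then show False using support_cases[of f j] f j by auto
  qed
  then have "(\<Sum>j\<in>W. x f j) = (\<Sum>j\<in>base f \<union> ?X. x f j)"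
    using baseD(2) extra_props(1) by (intro sum.mono_neutral_right) auto
  also have "\<dots> = (\<Sum>j\<in>base f. x f j) + (\<Sum>j\<in>?X. x f j)"
    using extra_notin_base by (intro sum.union_disjoint) auto
  also have "(\<Sum>j\<in>base f. x f j) =
      (\<Sum>j\<in>base f. 1 - (\<Sum>e | e \<in> feeders f \<and> extra e = j. x e (extra e)))"
  proof (rule sum.cong[OF refl])
    fix j assume j: "j \<in> base f"
    then have "{e. e \<in> fractional \<and> extra e = j} = {e. e \<in> feeders f \<and> extra e = j}"
      by (auto simp: feeders_def)
    then show "x f j = 1 - (\<Sum>e | e \<in> feeders f \<and> extra e = j. x e (extra e))"
      using base_value[OF j] by simp
  qed
  also have "\<dots> = real (card (base f)) - (\<Sum>j\<in>base f. \<Sum>e | e \<in> feeders f \<and> extra e = j. x e (extra e))"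
    by (simp add: sum_subtractf)
  also have "(\<Sum>j\<in>base f. \<Sum>e | e \<in> feeders f \<and> extra e = j. x e (extra e)) =
      (\<Sum>e\<in>feeders f. x e (extra e))"
    by (rule sum.group) (auto simp: feeders_def)
  finally show ?thesis by simp
qed

text \<open>Without feeders the row of \<open>f\<close> would be an integer plus a number strictly
  between 0 and 1, whereas a fractional firm has row sum equal to its quota.\<close>

lemma feeders_nonempty:
  assumes fr: "f \<in> fractional"
  shows "feeders f \<noteq> {}"
proof
  assume "feeders f = {}"
  then have "real (card (base f)) + x f (extra f) = real (q f)"
    using row_sum[OF fractional_firm[OF fr]] fsat_row[OF extra_props(4)[OF fr] fractional_firm[OF fr]] fr
    by simp
  then have "real (card (base f)) < real (q f)" "real (q f) < real (card (base f) + 1)"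
    using extra_props(2)[OF fr] extra_lt_1[OF fr] by auto
  then show False unfolding of_nat_less_iff by linarith
qed

definition pred :: "'f \<Rightarrow> 'f" where
  "pred f = (SOME e. e \<in> feeders f)"

lemma pred_feeder: "f \<in> fractional \<Longrightarrow> pred f \<in> feeders f"
  unfolding pred_def using feeders_nonempty by (simp add: some_in_eq)

lemma pred_fractional: "f \<in> fractional \<Longrightarrow> pred f \<in> fractional"
  and extra_pred: "f \<in> fractional \<Longrightarrow> extra (pred f) \<in> base f"
  using pred_feeder by (auto simp: feeders_def)

text \<open>
  Firms with a common predecessor coincide, so the choice of predecessors is injective on a finite
  set and hence surjective: no fractional firm has two predecessors.
\<close>

lemma pred_bij: "bij_betw pred fractional fractional"
proof -
  have inj: "inj_on pred fractional"
  proof (rule inj_onI)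
    fix f g assume "f \<in> fractional" "g \<in> fractional" "pred f = pred g"
    then show "f = g" using extra_pred[of f] extra_pred[of g] base_unique by simp
  qed
  moreover have "pred ` fractional \<subseteq> fractional" using pred_fractional by blast
  ultimately show ?thesis using endo_inj_surj[OF finite_fractional] by (simp add: bij_betw_def)
qed

text \<open>Surjectivity of \<open>pred\<close> writes \<open>e\<close> as \<open>pred g\<close>,
  and only one firm holds \<open>extra e\<close> in \<open>base\<close>, so \<open>g = f\<close>. In
  particular no weight flows into a firm without an extra edge.\<close>

lemma feeder_eq_pred:
  assumes "e \<in> feeders f"
  shows "f \<in> fractional \<and> e = pred f"
proof -
  have "e \<in> fractional" "extra e \<in> base f" using assms by (auto simp: feeders_def)
  then obtain g where g: "g \<in> fractional" "e = pred g"
    using pred_bij by (auto simp: bij_betw_def)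
  then have "g = f" using extra_pred[OF g(1)] \<open>extra e \<in> base f\<close> base_unique by simp
  then show ?thesis using g by simp
qed

lemma extra_inj: "e \<in> fractional \<Longrightarrow> e' \<in> fractional \<Longrightarrow> extra e = extra e' \<Longrightarrow> e = e'"
proof -
  assume e: "e \<in> fractional" "e' \<in> fractional" "extra e = extra e'"
  obtain g where g: "g \<in> fractional" "e = pred g"
    using pred_bij e(1) by (auto simp: bij_betw_def)
  then have "e \<in> feeders g" "e' \<in> feeders g"
    using extra_pred[OF g(1)] e by (auto simp: feeders_def)
  then show ?thesis using feeder_eq_pred[of e g] feeder_eq_pred[of e' g] by simp
qed

lemma feeders_fractional: "f \<in> fractional \<Longrightarrow> feeders f = {pred f}"
  using pred_feeder[of f] feeder_eq_pred[of _ f] by blast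

lemma feeders_integral: "f \<notin> fractional \<Longrightarrow> feeders f = {}"
  using feeder_eq_pred[of _ f] by blast

text \<open>With a single feeder, \<open>card (base f)\<close> and the quota differ by the
  difference of two numbers in the open unit interval. An integer of absolute value below 1 is 0, so
  inflow equals outflow.\<close>

lemma fractional_balance:
  assumes fr: "f \<in> fractional"
  shows "card (base f) = q f" "x (pred f) (extra (pred f)) = x f (extra f)"
proof -
  have eq: "real (card (base f)) - x (pred f) (extra (pred f)) + x f (extra f) = real (q f)"
    using row_sum[OF fractional_firm[OF fr]] fsat_row[OF extra_props(4)[OF fr] fractional_firm[OF fr]] fr
    by (simp add: feeders_fractional)
  note bounds = extra_props(2)[OF fr] extra_lt_1[OF fr] extra_props(2)[OF pred_fractional[OF fr]]
    extra_lt_1[OF pred_fractional[OF fr]]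
  have "real (card (base f)) < real (q f + 1)" "real (q f) < real (card (base f) + 1)"
    using eq bounds by simp_all
  then show c: "card (base f) = q f" unfolding of_nat_less_iff by linarith
  then show "x (pred f) (extra (pred f)) = x f (extra f)" using eq by simp
qed

text \<open>A firm that is not fractional has no feeders either, so its row sum is the integer
  \<open>card (base f)\<close>.\<close>

lemma card_base:
  assumes f: "f \<in> F"
  shows "card (base f) \<le> q f" "(\<Sum>j\<in>W. x f j) = real (q f) \<Longrightarrow> card (base f) = q f"
proof -
  have "card (base f) = q f \<or> real (card (base f)) = (\<Sum>j\<in>W. x f j)"
    using fractional_balance(1)[of f] row_sum[OF f] feeders_integral[of f] by (cases "f \<in> fractional") auto
  then show "card (base f) \<le> q f" "(\<Sum>j\<in>W. x f j) = real (q f) \<Longrightarrow> card (base f) = q f"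
    using row_le[OF f] by auto
qed

text \<open>Injectivity of \<open>extra\<close> leaves at most one term in the sum of
  \<open>base_value\<close>, and that term equals the weight of the extra edge of \<open>f\<close>
  by flow balance.\<close>

lemma base_value_cases:
  assumes w: "w \<in> base f"
  shows "x f w = (if f \<in> fractional \<and> w = extra (pred f) then 1 - x f (extra f) else 1)"
proof (cases "f \<in> fractional \<and> w = extra (pred f)")
  case True
  then have fr: "f \<in> fractional" and we: "w = extra (pred f)" by auto
  have "{e. e \<in> fractional \<and> extra e = w} = {pred f}"
    using extra_inj pred_fractional[OF fr] we by blast
  then show ?thesis using base_value[OF w] True fractional_balance(2)[OF fr] by simp
next
  case False
  have "{e. e \<in> fractional \<and> extra e = w} = {}"
    using feeder_eq_pred[of _ f] w False by (auto simp: feeders_def)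
  then show ?thesis using base_value[OF w] False by (simp only: sum.empty) simp
qed

section \<open>Rotating \<open>base\<close> along sets of fractional firms\<close>

definition rotation :: "'f set \<Rightarrow> 'f \<Rightarrow> 'w set" where
  "rotation A f = (if f \<in> A then insert (extra f) (base f - {extra (pred f)}) else base f)"

text \<open>The equivalence makes \<open>A\<close> a union of orbits of \<open>pred\<close>: a firm
  \<open>f\<close> releases \<open>extra (pred f)\<close> exactly when \<open>pred f\<close> takes
  her.\<close>

definition pred_closed :: "'f set \<Rightarrow> bool" where
  "pred_closed A \<longleftrightarrow> A \<subseteq> fractional \<and> (\<forall>f\<in>fractional. pred f \<in> A \<longleftrightarrow> f \<in> A)"

lemma rotation_empty: "rotation {} = base"
  by (auto simp: rotation_def)

lemma rotation_support:
  assumes A: "pred_closed A" and w: "w \<in> rotation A f"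
  shows "f \<in> F" "w \<in> W" "0 < x f w"
proof -
  have "w \<in> base f \<or> f \<in> fractional \<and> w = extra f"
    using w A unfolding rotation_def pred_closed_def by (auto split: if_splits)
  then show "f \<in> F" "w \<in> W" "0 < x f w"
    using baseD[of w f] extra_props[of f] fractional_firm[of f] by blast+
qed

lemma card_rotation:
  assumes A: "pred_closed A"
  shows "card (rotation A f) = card (base f)"
proof (cases "f \<in> A")
  case True
  then have fr: "f \<in> fractional" using A by (auto simp: pred_closed_def)
  have "card (base f) > 0" using extra_pred[OF fr] by (auto simp: card_gt_0_iff)
  then show ?thesis
    using True extra_notin_base[OF fr] extra_pred[OF fr]
    by (simp add: rotation_def card_insert_if card_Diff_singleton)
qed (simp add: rotation_def)

text \<open>A worker gained by a firm of \<open>A\<close> was held in \<open>base\<close> by a firm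
  with that predecessor; by closure this firm also lies in \<open>A\<close> and has released her.
  Two firms gaining the same worker coincide by \<open>extra_inj\<close>.\<close>

lemma rotation_disjoint:
  assumes A: "pred_closed A" and w: "w \<in> rotation A f" "w \<in> rotation A g"
  shows "f = g"
proof -
  have *: "f = g" if w: "w \<in> rotation A f" "w \<in> rotation A g" and f: "f \<in> A" "w = extra f" for f g
  proof (cases "g \<in> A \<and> w = extra g")
    case True
    then show ?thesis using extra_inj[of f g] f A by (auto simp: pred_closed_def)
  next
    case False
    have fr: "f \<in> fractional" using A f by (auto simp: pred_closed_def)
    have wg: "w \<in> base g" "\<not> (g \<in> A \<and> w = extra (pred g))"
      using w(2) False by (auto simp: rotation_def split: if_splits)
    then have "g \<in> fractional \<and> f = pred g"
      using feeder_eq_pred[of f g] fr f by (auto simp: feeders_def)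
    then show ?thesis using wg f A by (auto simp: pred_closed_def)
  qed
  show ?thesis
  proof (cases "f \<in> A \<and> w = extra f \<or> g \<in> A \<and> w = extra g")
    case True
    then show ?thesis using *[of f g] *[of g f] w by auto
  next
    case False
    then have "w \<in> base f" "w \<in> base g" using w by (auto simp: rotation_def split: if_splits)
    then show ?thesis by (rule base_unique)
  qed
qed

text \<open>Each worker with positive weight is in some \<open>base g\<close>, since the extra
  worker of \<open>pred h\<close> is held by \<open>h\<close>. If \<open>g\<close> releases her,
  \<open>pred g\<close> takes her.\<close>

lemma rotation_covers:
  assumes A: "pred_closed A" and f: "f \<in> F" and w: "w \<in> W" and x: "0 < x f w"
  shows "\<exists>g. w \<in> rotation A g"
proof -
  obtain g where g: "w \<in> base g"
  proof (cases "w \<in> base f")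
    case False
    then have fr: "f \<in> fractional" "w = extra f" using support_cases[OF f w x] by auto
    then obtain h where "h \<in> fractional" "f = pred h"
      using pred_bij by (auto simp: bij_betw_def)
    then show ?thesis using extra_pred[of h] fr that by simp
  qed (use that in blast)
  show ?thesis
  proof (cases "g \<in> A \<and> w = extra (pred g)")
    case True
    then have "pred g \<in> A" using A by (auto simp: pred_closed_def)
    then show ?thesis using True by (auto simp: rotation_def)
  next
    case False
    then have "w \<in> rotation A g" using g by (auto simp: rotation_def)
    then show ?thesis by blast
  qed
qed

lemma rotation_matching:
  assumes A: "pred_closed A"
  shows "is_matching G (rotation A)"
  unfolding is_matching_def
proof (intro conjI ballI allI impI)
  show "rotation A f \<subseteq> W" for f using rotation_support(2)[OF A] by blast
  show "card (rotation A f) \<le> q f" if "f \<in> F" for f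
    using card_rotation[OF A] card_base(1)[OF that] by simp
  show "rotation A f = {}" if "f \<notin> F" for f using rotation_support(1)[OF A] that by blast
  show "rotation A f \<inter> rotation A g = {}" if "f \<noteq> g" for f g using rotation_disjoint[OF A] that by blast
qed

text \<open>If the edge were \<open>wsat\<close>, the column of \<open>w\<close> would sum to 1, so
  the rotation would match \<open>w\<close> to a firm of her support. All such firms are weakly
  above \<open>f\<close>, contrary to her preferring \<open>f\<close>.\<close>

lemma preferred_to_rotation_fsat:
  assumes A: "pred_closed A" and acc: "(f, w) \<in> acceptable G"
    and pr: "wpref G w (Some f) (partner G (rotation A) w)"
  shows "fsat f w"
proof -
  have fw: "f \<in> F" "w \<in> W" using acc by (auto simp: acceptable_iff)
  note part = partner_eq_Some_iff[OF rotation_matching[OF A]]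
  have "\<not> wsat f w"
  proof
    assume sat: "wsat f w"
    have "\<exists>i\<in>F. 0 < x i w"
    proof (rule ccontr)
      assume "\<not> ?thesis"
      then have "(\<Sum>i\<in>F. x i w) = 0" using x_nonneg[OF _ fw(2)] by (intro sum.neutral) force
      then show False using wsat_col[OF sat fw(2)] by simp
    qed
    then obtain g where g: "w \<in> rotation A g" using rotation_covers[OF A _ fw(2)] by blast
    note gs = rotation_support[OF A g]
    have "wpref G w (Some f) (Some g)" using pr part g by metis
    then show False
      using wsat_support[OF sat fw(2) gs(1,3)] wpref_asym[OF fw(2), of "Some f" "Some g"]
        wpref_irrefl[OF fw(2), of "Some f"] fw gs(1) by auto
  qed
  then show ?thesis using fsat_or_wsat[OF acc] by blast
qed

text \<open>A worker \<open>w\<close> who prefers \<open>f\<close> makes the edge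
  \<open>fsat\<close>: the row of \<open>f\<close> then sums to the quota, so \<open>f\<close> is
  full, and the members of \<open>rotation A f\<close>, all in the support of \<open>f\<close>, rank
  above \<open>w\<close>.\<close>

lemma rotation_stable:
  assumes A: "pred_closed A"
  shows "stable G (rotation A)"
proof (rule stableI[OF rotation_matching[OF A]])
  show "(f, w) \<in> acceptable G" if "w \<in> rotation A f" for f w
    using rotation_support[OF A that] x_pos_acceptable by blast
  fix f w assume acc: "(f, w) \<in> acceptable G" and pr: "wpref G w (Some f) (partner G (rotation A) w)"
  have fw: "f \<in> F" "w \<in> W" using acc by (auto simp: acceptable_iff)
  note sat = preferred_to_rotation_fsat[OF A acc pr]
  have "partner G (rotation A) w \<noteq> Some f" using pr wpref_irrefl[OF fw(2), of "Some f"] fw(1) by auto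
  then have "w \<notin> rotation A f" using partner_eq_Some_iff[OF rotation_matching[OF A]] by blast
  moreover have "j = w \<or> fpref G f {j} {w}" if "j \<in> rotation A f" for j
    using fsat_support[OF sat] rotation_support[OF A that] by blast
  ultimately show "card (rotation A f) = q f \<and> (\<forall>j\<in>rotation A f. fpref G f {j} {w})"
    using card_rotation[OF A] card_base(2)[OF fw(1) fsat_row[OF sat fw(1)]] by auto
qed

lemma pred_closed_empty: "pred_closed {}" and pred_closed_fractional: "pred_closed fractional"
  using pred_fractional by (auto simp: pred_closed_def)

lemma base_stable: "stable G base"
  using rotation_stable[OF pred_closed_empty] by (simp add: rotation_empty)

text \<open>The stable matching \<open>rotation fractional\<close> gives \<open>extra f\<close> the
  firm \<open>f\<close>, so \<open>mu_W G\<close> gives her at least \<open>f\<close>, as membership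
  in the list requires. She is best because every listed \<open>v\<close> outside
  \<open>base f\<close> prefers \<open>f\<close> to her base partner; the edge \<open>(f, v)\<close>
  is therefore \<open>fsat\<close>, and no support worker of \<open>f\<close> ranks below
  \<open>v\<close>.\<close>

lemma extra_is_best:
  assumes fr: "f \<in> fractional"
  shows "is_best_worker G f (firm_list G base f - base f) (extra f)"
proof -
  note e = extra_props[OF fr] and f = fractional_firm[OF fr]
  note fl = firm_list_diff_iff[OF base_stable]
  note rs = rotation_stable[OF pred_closed_fractional]
  note stW = mu_W_stable[OF base_stable]
  have acc: "(f, extra f) \<in> acceptable G" using x_pos_acceptable[OF f e(1,2)] .
  obtain g where g: "g \<in> fractional" "f = pred g" using pred_bij fr by (auto simp: bij_betw_def)
  have eg: "extra f \<in> base g" using extra_pred[OF g(1)] g(2) by simp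
  then have "partner G base (extra f) = Some g"
    using partner_eq_Some_iff[OF stable_matching[OF base_stable]] by blast
  moreover have "f \<noteq> g" using eg extra_notin_base[OF fr] by auto
  ultimately have pr: "wpref G (extra f) (Some f) (partner G base (extra f))"
    using wsat_support[OF baseD(4)[OF eg] e(1) f e(2)] by simp
  have er: "extra f \<in> rotation fractional f" using fr by (simp add: rotation_def)
  then have "partner G (rotation fractional) (extra f) = Some f"
    using partner_eq_Some_iff[OF stable_matching[OF rs]] by blast
  then have best: "wpref_eq (extra f) (partner G (mu_W G) (extra f)) (Some f)"
    using mu_W_best[OF rs e(1)] by simp
  have "\<not> (mu_W G f \<noteq> {} \<and> fpref G f {worst_worker G f (mu_W G f)} {extra f})"
  proof
    assume a: "mu_W G f \<noteq> {} \<and> fpref G f {worst_worker G f (mu_W G f)} {extra f}"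
    then have ne: "mu_W G f \<noteq> {}" and lt: "fpref G f {worst_worker G f (mu_W G f)} {extra f}" by auto
    note worst = worst_worker_mu_W[OF base_stable f ne]
    have out: "extra f \<notin> mu_W G f"
    proof
      assume "extra f \<in> mu_W G f"
      from worst(3)[OF this] show False
        using lt fpref_asym[OF f worst(2) e(1)] fpref_irrefl[OF f e(1)] by auto
    qed
    \<comment> \<open>The two sets have equal size, so some \<open>v\<close> belongs to
      \<open>mu_W G f\<close> only. She prefers \<open>f\<close> to her partner in the rotation,
      whose stability puts \<open>extra f\<close> above \<open>v\<close>; but \<open>v\<close> is at
      least the worst worker of \<open>mu_W G f\<close>, assumed to be above
      \<open>extra f\<close>.\<close>
    have "mu_W G f \<noteq> rotation fractional f" using out er by auto
    moreover have "finite (mu_W G f)" "finite (rotation fractional f)"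
      using finite_subset[OF _ finite_workers] matching_memD(2)[OF stable_matching[OF stW]]
        matching_memD(2)[OF stable_matching[OF rs]] by (meson subsetI)+
    ultimately have "\<not> mu_W G f \<subseteq> rotation fractional f"
      using card_subset_eq stable_card_eq[OF stW rs, of f] by blast
    then obtain v where v: "v \<in> mu_W G f" "v \<notin> rotation fractional f" by blast
    have vW: "v \<in> W" using matching_memD(2)[OF stable_matching[OF stW] v(1)] .
    have "partner G (mu_W G) v = Some f" "partner G (rotation fractional) v \<noteq> Some f"
      using v partner_eq_Some_iff[OF stable_matching[OF stW]]
        partner_eq_Some_iff[OF stable_matching[OF rs]] by blast+
    then have "wpref G v (Some f) (partner G (rotation fractional) v)"
      using mu_W_best[OF rs vW] unfolding wpref_eq_def by auto
    then have "fpref G f {extra f} {v}"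
      using stable_no_block(2)[OF rs stable_acceptable[OF stW v(1)] _ er] by blast
    moreover have "fpref G f {v} {extra f}"
      using worst(3)[OF v(1)] lt fpref_trans[OF f vW worst(2) e(1)] by auto
    ultimately show False using fpref_asym[OF f vW e(1)] by blast
  qed
  then have "extra f \<in> firm_list G base f - base f" unfolding fl using acc pr best by blast
  moreover have "fpref G f {extra f} {v} \<or> extra f = v" if "v \<in> firm_list G base f - base f" for v
  proof -
    have "(f, v) \<in> acceptable G" "wpref G v (Some f) (partner G (rotation {}) v)"
      using that unfolding fl rotation_empty by blast+
    then have "fsat f v" by (rule preferred_to_rotation_fsat[OF pred_closed_empty])
    then show ?thesis using fsat_support[OF _ f e(1,2)] by blast
  qed
  ultimately show ?thesis unfolding is_best_worker_def by blast
qed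

section \<open>Cycles of the reduced profile as orbits of a permutation\<close>

lemma cycle_worker_eq_extra: "f \<in> fractional \<Longrightarrow> cycle_worker G base f = extra f"
  unfolding cycle_worker_def
  using best_worker_eqI[OF fractional_firm _ extra_is_best] firm_list_subset by blast

text \<open>The inverse of \<open>pred\<close> is taken because a cycle lists a firm before the
  holder of its attached worker. Being the identity elsewhere makes it a permutation of the whole
  type.\<close>

definition succ :: "'f \<Rightarrow> 'f" where
  "succ f = (if f \<in> fractional then inv_into fractional pred f else f)"

text \<open>The list \<open>support succ f\<close> consists of \<open>f\<close> and its iterates up
  to the first return, so it also serves as the enumeration that \<open>is_cycle\<close> asks
  for.\<close>

definition succ_orbit :: "'f \<Rightarrow> 'f set" where
  "succ_orbit f = set (support succ f)"

lemma succ_permutation: "permutation succ"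
proof -
  have "bij_betw succ fractional fractional \<longleftrightarrow> bij_betw (inv_into fractional pred) fractional fractional"
    by (rule bij_betw_cong) (simp add: succ_def)
  then have "bij_betw succ fractional fractional" using bij_betw_inv_into[OF pred_bij] by simp
  then have "succ permutes fractional" by (rule bij_imp_permutes) (simp add: succ_def)
  then show ?thesis using permutation_permutes finite_fractional by blast
qed

lemma succ_fractional: "f \<in> fractional \<Longrightarrow> succ f \<in> fractional"
  and pred_succ: "f \<in> fractional \<Longrightarrow> pred (succ f) = f"
  and succ_pred: "f \<in> fractional \<Longrightarrow> succ (pred f) = f"
  using pred_bij pred_fractional[of f] unfolding succ_def bij_betw_def
  by (auto simp: inv_into_into f_inv_into_f)

lemma succ_orbit_eq: "succ_orbit f = range (\<lambda>i. (succ ^^ i) f)"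
  unfolding succ_orbit_def by (rule support_set[OF succ_permutation])

lemma self_in_succ_orbit: "f \<in> succ_orbit f"
  unfolding succ_orbit_eq by (rule range_eqI[of _ _ 0]) simp

lemma succ_in_succ_orbit: "succ f \<in> succ_orbit f"
  unfolding succ_orbit_eq by (rule range_eqI[of _ _ 1]) simp

lemma succ_orbit_cong: "f \<in> succ_orbit g \<Longrightarrow> succ_orbit f = succ_orbit g"
  using disjoint_support[OF succ_permutation] self_in_succ_orbit[of f]
  unfolding disjoint_def succ_orbit_def by blast

lemma funpow_succ_fractional:
  "f \<in> fractional \<Longrightarrow> (succ ^^ i) f \<in> fractional \<and> x ((succ ^^ i) f) (extra ((succ ^^ i) f)) = x f (extra f)"
proof (induction i)
  case (Suc i)
  then have fr: "(succ ^^ i) f \<in> fractional" by blast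
  show ?case
    using Suc fractional_balance(2)[OF succ_fractional[OF fr]]
    by (simp only: funpow.simps comp_apply pred_succ[OF fr] succ_fractional[OF fr])
qed simp

lemma succ_orbit_fractional: "f \<in> fractional \<Longrightarrow> g \<in> succ_orbit f \<Longrightarrow> g \<in> fractional"
  and succ_orbit_weight: "f \<in> fractional \<Longrightarrow> g \<in> succ_orbit f \<Longrightarrow> x g (extra g) = x f (extra f)"
  using funpow_succ_fractional unfolding succ_orbit_eq by auto

lemma succ_orbit_is_cycle:
  assumes fr: "f \<in> fractional"
  shows "succ_orbit f \<in> cycles G base"
proof -
  let ?es = "support succ f"
  let ?r = "least_power succ f"
  note lp = least_power_of_permutation[OF succ_permutation, of f]
  \<comment> \<open>The modulus matters only at the last index, where one more application of
    \<open>succ\<close> returns to \<open>f\<close>.\<close>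
  have next_es: "?es ! (Suc d mod length ?es) = succ (?es ! d)" if "d < ?r" for d
  proof (cases "Suc d < ?r")
    case False
    then have "Suc d = ?r" using that by simp
    then have "succ ((succ ^^ d) f) = f" using lp(1) by (metis funpow.simps(2) comp_apply)
    then show ?thesis using \<open>Suc d = ?r\<close> that lp(2) by simp
  qed (use that in simp)
  have "is_cycle G base (succ_orbit f)"
    unfolding is_cycle_def
  proof (intro exI[of _ ?es] exI[of _ "map extra ?es"] conjI allI impI)
    show "?es \<noteq> []" using lp(2) by simp
    show "distinct ?es" by (rule cycle_of_permutation[OF succ_permutation])
    show "succ_orbit f = set ?es" by (rule succ_orbit_def)
    show "succ_orbit f \<subseteq> F" using succ_orbit_fractional[OF fr] fractional_firm by blast
    fix d assume "d < length ?es"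
    then have d: "d < ?r" by simp
    have "?es ! d \<in> fractional" using funpow_succ_fractional[OF fr, of d] d by simp
    then show "is_best_worker G (?es ! d) (firm_list G base (?es ! d) - base (?es ! d)) (map extra ?es ! d)"
      and "map extra ?es ! d \<in> base (?es ! (Suc d mod length ?es))"
      using extra_is_best extra_pred[OF succ_fractional] pred_succ next_es[OF d] d by auto
  qed simp
  then show ?thesis by (simp add: cycles_def)
qed

lemma orbit_mem_eq:
  assumes K: "K \<subseteq> succ_orbit ` fractional" and \<sigma>: "\<sigma> \<in> K" "f \<in> \<sigma>"
  shows "\<sigma> = succ_orbit f"
proof -
  obtain g where "\<sigma> = succ_orbit g" using K \<sigma>(1) by blast
  then show ?thesis using succ_orbit_cong[of f g] \<sigma>(2) by simp
qed

lemma mem_orbit_union_iff: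
  assumes K: "K \<subseteq> succ_orbit ` fractional"
  shows "f \<in> \<Union>K \<longleftrightarrow> succ_orbit f \<in> K"
proof
  assume "f \<in> \<Union>K"
  then obtain \<sigma> where "\<sigma> \<in> K" "f \<in> \<sigma>" by blast
  then show "succ_orbit f \<in> K" using orbit_mem_eq[OF K, of \<sigma> f] by simp
qed (use self_in_succ_orbit[of f] in blast)

lemma pred_in_orbit:
  assumes "f \<in> fractional"
  shows "succ_orbit (pred f) = succ_orbit f"
  using succ_orbit_cong[of f "pred f"] succ_in_succ_orbit[of "pred f"] succ_pred[OF assms] by simp

lemma orbit_union_closed:
  assumes "K \<subseteq> succ_orbit ` fractional"
  shows "pred_closed (\<Union>K)"
  unfolding pred_closed_def
proof (intro conjI ballI)
  show "\<Union>K \<subseteq> fractional" using assms succ_orbit_fractional by blast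
  show "pred f \<in> \<Union>K \<longleftrightarrow> f \<in> \<Union>K" if "f \<in> fractional" for f
    unfolding mem_orbit_union_iff[OF assms] pred_in_orbit[OF that] ..
qed

text \<open>Both definite descriptions resolve here: distinct orbits are disjoint, so the cycle
  through \<open>f\<close> is unique, and the only feeder of \<open>f\<close> is
  \<open>pred f\<close>.\<close>

lemma multi_cyclic_matching_base:
  assumes K: "K \<subseteq> succ_orbit ` fractional"
  shows "multi_cyclic_matching G base K = rotation (\<Union>K)"
proof
  fix f
  show "multi_cyclic_matching G base K f = rotation (\<Union>K) f"
  proof (cases "f \<in> \<Union>K")
    case True
    then obtain \<sigma> where s: "\<sigma> \<in> K" "f \<in> \<sigma>" by blast
    have fr: "f \<in> fractional" using True orbit_union_closed[OF K] unfolding pred_closed_def by blast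
    have sub: "\<sigma> \<subseteq> fractional" using orbit_union_closed[OF K] s unfolding pred_closed_def by blast
    note orb = orbit_mem_eq[OF K]
    have the: "(THE \<sigma>. \<sigma> \<in> K \<and> f \<in> \<sigma>) = \<sigma>"
    proof (rule the_equality)
      show "\<tau> = \<sigma>" if "\<tau> \<in> K \<and> f \<in> \<tau>" for \<tau>
        using orb[OF s] orb[of \<tau> f] that by simp
    qed (use s in blast)
    have pin: "pred f \<in> \<sigma>"
      using orb[OF s] pred_in_orbit[OF fr] self_in_succ_orbit[of "pred f"] by simp
    have "cycle_pred G base \<sigma> f = pred f"
      unfolding cycle_pred_def
    proof (rule the_equality)
      show "pred f \<in> \<sigma> \<and> cycle_worker G base (pred f) \<in> base f"
        using pin cycle_worker_eq_extra[OF pred_fractional[OF fr]] extra_pred[OF fr] by simp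
      show "e = pred f" if "e \<in> \<sigma> \<and> cycle_worker G base e \<in> base f" for e
        using that sub cycle_worker_eq_extra[of e] feeder_eq_pred[of e f] by (auto simp: feeders_def)
    qed
    then show ?thesis
      using True s the cycle_worker_eq_extra[OF fr] cycle_worker_eq_extra[OF pred_fractional[OF fr]]
      by (auto simp: multi_cyclic_matching_def cyclic_matching_def rotation_def)
  qed (auto simp: multi_cyclic_matching_def rotation_def)
qed

section \<open>Coordinates on the cube of rotations and the resulting equivalence\<close>

lemma connected_decomposition:
  "\<exists>M. connected_matchings G M \<and>
      (\<exists>(k :: nat) (\<mu> :: nat \<Rightarrow> 'f \<Rightarrow> 'w set) (\<alpha> :: nat \<Rightarrow> real).
        (\<forall>l \<in> {1..k}. \<mu> l \<in> M \<and> 0 < \<alpha> l \<and> \<alpha> l \<le> 1) \<and>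
        (\<Sum>l = 1..k. \<alpha> l) = 1 \<and>
        (\<forall>f \<in> F. \<forall>w \<in> W. x f w = (\<Sum>l = 1..k. \<alpha> l * incidence G (\<mu> l) f w)))"
proof -
  let ?O = "succ_orbit ` fractional"
  \<comment> \<open>The weight of the extra edge is constant along an orbit, so any representative
    gives the coordinate of the orbit.\<close>
  define \<beta> where "\<beta> \<sigma> = (let f = SOME f. f \<in> \<sigma> in x f (extra f))" for \<sigma>
  have \<beta>: "\<beta> (succ_orbit f) = x f (extra f)" if "f \<in> fractional" for f
  proof -
    have "(SOME g. g \<in> succ_orbit f) \<in> succ_orbit f"
      using self_in_succ_orbit by (rule someI)
    then show ?thesis using succ_orbit_weight[OF that] by (simp add: \<beta>_def Let_def)
  qed
  have frac: "0 < \<beta> \<sigma> \<and> \<beta> \<sigma> < 1" if "\<sigma> \<in> ?O" for \<sigma>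
    using that \<beta> extra_props(2) extra_lt_1 by auto
  obtain k :: nat and K :: "nat \<Rightarrow> 'f set set" and \<alpha> :: "nat \<Rightarrow> real"
    where K: "\<And>l. l \<in> {1..k} \<Longrightarrow> K l \<subseteq> ?O" and \<alpha>: "\<And>l. l \<in> {1..k} \<Longrightarrow> 0 < \<alpha> l \<and> \<alpha> l \<le> 1"
      and sum1: "(\<Sum>l = 1..k. \<alpha> l) = 1"
      and sum\<beta>: "\<And>\<sigma>. \<sigma> \<in> ?O \<Longrightarrow> (\<Sum>l = 1..k. \<alpha> l * of_bool (\<sigma> \<in> K l)) = \<beta> \<sigma>"
    by (rule cube_convex_combination[of ?O \<beta>]) (simp, rule frac, assumption, rule that)
  let ?M = "{multi_cyclic_matching G base K | K. K \<subseteq> ?O}"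
  have "stable G \<nu>" if "\<nu> \<in> ?M" for \<nu>
    using that multi_cyclic_matching_base rotation_stable[OF orbit_union_closed] by auto
  then have "connected_matchings G ?M"
    unfolding connected_matchings_def using base_stable succ_orbit_is_cycle by blast
  moreover have "x f w = (\<Sum>l = 1..k. \<alpha> l * incidence G (multi_cyclic_matching G base (K l)) f w)"
    if f: "f \<in> F" and w: "w \<in> W" for f w
  proof -
    \<comment> \<open>The incidence vector depends affinely on the indicator of the orbit of
      \<open>f\<close> in \<open>K l\<close>: an extra edge is present exactly when the orbit is
      chosen, the released base edge exactly when it is not, and all other entries are
      constant.\<close>
    have inc: "incidence G (multi_cyclic_matching G base (K l)) f w =
      (if f \<in> fractional \<and> w = extra f then of_bool (succ_orbit f \<in> K l)
       else if f \<in> fractional \<and> w = extra (pred f) then 1 - of_bool (succ_orbit f \<in> K l)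
       else of_bool (w \<in> base f))" if l: "l \<in> {1..k}" for l
    proof -
      note A = orbit_union_closed[OF K[OF l]]
      have mem: "f \<in> \<Union>(K l) \<longleftrightarrow> f \<in> fractional \<and> succ_orbit f \<in> K l"
        using A mem_orbit_union_iff[OF K[OF l], of f] unfolding pred_closed_def by blast
      have "incidence G (multi_cyclic_matching G base (K l)) f w = of_bool (w \<in> rotation (\<Union>(K l)) f)"
        unfolding multi_cyclic_matching_base[OF K[OF l]] incidence_def
        using partner_eq_Some_iff[OF rotation_matching[OF A], of w f] by simp
      then show ?thesis
        unfolding rotation_def mem using extra_notin_base[of f] extra_pred[of f] by auto
    qed
    have compl: "(\<Sum>l = 1..k. \<alpha> l * (1 - of_bool (\<sigma> \<in> K l))) = 1 - \<beta> \<sigma>" if "\<sigma> \<in> ?O" for \<sigma>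
      using sum\<beta>[OF that] sum1 by (simp add: right_diff_distrib sum_subtractf)
    have "(\<Sum>l = 1..k. \<alpha> l * incidence G (multi_cyclic_matching G base (K l)) f w) =
      (if f \<in> fractional \<and> w = extra f then x f (extra f)
       else if f \<in> fractional \<and> w = extra (pred f) then 1 - x f (extra f)
       else of_bool (w \<in> base f))"
    proof (cases "f \<in> fractional \<and> (w = extra f \<or> w = extra (pred f))")
      case True
      then have "succ_orbit f \<in> ?O" by blast
      note sums = sum\<beta>[OF this] compl[OF this]
      show ?thesis
      proof (cases "w = extra f")
        case w: True
        have "(\<Sum>l = 1..k. \<alpha> l * incidence G (multi_cyclic_matching G base (K l)) f w) =
            (\<Sum>l = 1..k. \<alpha> l * of_bool (succ_orbit f \<in> K l))"
          by (rule sum.cong) (use inc True w in auto)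
        then show ?thesis using sums(1) True w \<beta> by simp
      next
        case w: False
        have "(\<Sum>l = 1..k. \<alpha> l * incidence G (multi_cyclic_matching G base (K l)) f w) =
            (\<Sum>l = 1..k. \<alpha> l * (1 - of_bool (succ_orbit f \<in> K l)))"
          by (rule sum.cong) (use inc True w in auto)
        then show ?thesis using sums(2) True w \<beta> by simp
      qed
    next
      case False
      then have "incidence G (multi_cyclic_matching G base (K l)) f w = of_bool (w \<in> base f)"
        if "l \<in> {1..k}" for l
        using inc[OF that] by auto
      then show ?thesis using False sum1 by (auto simp flip: sum_distrib_right)
    qed
    \<comment> \<open>The averaged coordinates agree with \<open>base_value_cases\<close> on base
      edges; an edge that is neither base nor extra lies outside the support and has weight
      0.\<close>
    also have "\<dots> = x f w"
      using base_value_cases[of w f] support_cases[OF f w] extra_pred[of f] x_nonneg[OF f w, unfolded le_less]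
      by auto
    finally show ?thesis by simp
  qed
  moreover have "multi_cyclic_matching G base (K l) \<in> ?M" if "l \<in> {1..k}" for l
    using K[OF that] by blast
  ultimately show ?thesis
    using \<alpha> sum1
    by (intro exI[of _ ?M] conjI exI[of _ k] exI[of _ "\<lambda>l. multi_cyclic_matching G base (K l)"]
        exI[of _ \<alpha>] ballI) simp_all
qed

end

theorem theorem2:
  fixes G :: "('f, 'w) market" and x :: "'f \<Rightarrow> 'w \<Rightarrow> real"
  assumes "many_to_one_market G"
    and "stable_fractional_matching G x"
  shows "strongly_stable G x \<longleftrightarrow>
    (\<exists>M. connected_matchings G M \<and>
      (\<exists>(k :: nat) (\<mu> :: nat \<Rightarrow> 'f \<Rightarrow> 'w set) (\<alpha> :: nat \<Rightarrow> real).
        (\<forall>l \<in> {1..k}. \<mu> l \<in> M \<and> 0 < \<alpha> l \<and> \<alpha> l \<le> 1) \<and>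
        (\<Sum>l = 1..k. \<alpha> l) = 1 \<and>
        (\<forall>f \<in> firms G. \<forall>w \<in> workers G.
          x f w = (\<Sum>l = 1..k. \<alpha> l * incidence G (\<mu> l) f w))))"
    (is "_ \<longleftrightarrow> ?R")
proof
  interpret m2o_market G by unfold_locales (rule assms(1))
  show ?R if "strongly_stable G x"
  proof -
    interpret strongly_stable_point G x by unfold_locales (rule that)
    show ?thesis by (rule connected_decomposition)
  qed
  assume ?R
  then obtain M and k :: nat and \<mu> :: "nat \<Rightarrow> 'f \<Rightarrow> 'w set" and \<alpha> :: "nat \<Rightarrow> real"
    where M: "connected_matchings G M" "\<And>l. l \<in> {1..k} \<Longrightarrow> \<mu> l \<in> M" "(\<Sum>l = 1..k. \<alpha> l) = 1"
      "\<And>f w. f \<in> firms G \<Longrightarrow> w \<in> workers G \<Longrightarrow> x f w = (\<Sum>l = 1..k. \<alpha> l * incidence G (\<mu> l) f w)"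
    by blast
  show "strongly_stable G x"
    unfolding strongly_stable_def
    using assms(2) connected_convex_combination_product[OF M] by blast
qed

end
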